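(* Consider the Gaussian white noise regression model in wavelet form: given $f$, one observes independently $X_{lk}\mid f_{lk}\sim\mathcal N(f_{lk},1/n)$ for $l\ge0$, $k\in\mathcal K_l$, and write $X^{(n)}=(X_{lk})_{l,k}$. Let $h$ be a probability density on $\mathbb R$ such that: (i) $h$ is symmetric, positive, bounded, and decreasing on $[0,\infty)$; (ii) for some $c_1>0$, $\kappa\ge0$, $\log(1/h(x))\le c_1(1+\log^{1+\kappa}(1+x))$ for all $x\ge0$; (iii) $\int_{-\infty}^\infty x^2h(x)\,dx<\infty$. Let $\Pi$ be the prior on $f$ under which $f_{lk}=s_l\zeta_{lk}$ with $(\zeta_{lk})$ i.i.d. of density $h$ and $s_l=2^{-l^2}$. Suppose $f_0\in\mathcal B^\beta_{rr}(L)$ for some $\beta,L>0$, $r\in[1,2]$ and $\beta>1/r-1/2$. Then there exists $d>0$ such that, with $\mathcal L_n=(\log n)^d$, as $n\to\infty$, $$E_{f_0}\Pi\left[\{f:\ \|f-f_0\|_2>\mathcal L_n\,n^{-\beta/(2\beta+1)}\}\,\middle|\,X^{(n)}\right]\to0.$$ Further, the same result holds, with a possibly different $d$, when instead $s_l=2^{-l(1/2+\alpha)}$ for some $\alpha>0$, provided $\alpha\ge\beta$.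
   Context: $\{\psi_{lk}:l\ge0,k\in\mathcal K_l\}$, $\mathcal K_l=\{0,\dots,2^l-1\}$, is an orthonormal boundary-corrected wavelet basis of $L^2[0,1]$ (the scaling function being denoted as the first wavelet $\psi_{00}$). Functions are identified with their coefficients $f_{lk}=\langle f,\psi_{lk}\rangle$, so $\|f\|_2^2=\sum_{l,k}f_{lk}^2$. The Besov-type ball is $\mathcal B^\beta_{rr}(L)=\{f=(f_{lk}):\ \sum_{l\ge0}2^{rl(\beta+1/2-1/r)}\sum_{k\in\mathcal K_l}|f_{lk}|^r<L^r\}$. $\Pi[\cdot\mid X^{(n)}]$ is the posterior distribution of $f$ given $X^{(n)}$: under it the $f_{lk}$ are independent, $f_{lk}$ having density proportional to $\theta\mapsto e^{-n(X_{lk}-\theta)^2/2}h(\theta/s_l)$. $E_{f_0}$ is the expectation when $X_{lk}\sim\mathcal N(f_{0,lk},1/n)$ independently. *)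

theory Defs
  imports "HOL-Probability.Probability"
begin

text \<open>
  Functions on the unit interval are represented by their wavelet coefficients, indexed by the
  pairs \<open>(l, k)\<close> of a level \<open>l\<close> and a location \<open>k < 2 ^ l\<close>.  Values of a coefficient family outside
  \<open>wavelet_index\<close> are irrelevant to every notion below.
\<close>

definition wavelet_index :: "(nat \<times> nat) set" where
  "wavelet_index = (SIGMA l:UNIV. {..<2 ^ l})"

text \<open>By Parseval this is the norm of \<open>L\<^sup>2[0,1]\<close>; it is infinite for a family that is not square
  summable, i.e. not the coefficient family of a function in \<open>L\<^sup>2[0,1]\<close>.\<close>

definition L2_norm :: "(nat \<times> nat \<Rightarrow> real) \<Rightarrow> ennreal" where
  "L2_norm f =
     (if (\<lambda>i. (f i)\<^sup>2) summable_on wavelet_index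
      then ennreal (sqrt (\<Sum>\<^sub>\<infinity>i\<in>wavelet_index. (f i)\<^sup>2)) else \<infinity>)"

definition besov_ball :: "real \<Rightarrow> real \<Rightarrow> real \<Rightarrow> (nat \<times> nat \<Rightarrow> real) set" where
  "besov_ball \<beta> r L =
     {f. summable (\<lambda>l. 2 powr (r * real l * (\<beta> + 1/2 - 1/r)) * (\<Sum>k<2 ^ l. \<bar>f (l, k)\<bar> powr r)) \<and>
         (\<Sum>l. 2 powr (r * real l * (\<beta> + 1/2 - 1/r)) * (\<Sum>k<2 ^ l. \<bar>f (l, k)\<bar> powr r)) < L powr r}"

definition observation_law :: "nat \<Rightarrow> (nat \<times> nat \<Rightarrow> real) \<Rightarrow> (nat \<times> nat \<Rightarrow> real) measure" where
  "observation_law n f =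
     (\<Pi>\<^sub>M i\<in>wavelet_index. density lborel (normal_density (f i) (1 / sqrt (real n))))"

text \<open>The law of one coefficient \<open>s * \<zeta>\<close> under the prior, where \<open>\<zeta>\<close> has density \<open>h\<close>.\<close>

definition prior_coord :: "(real \<Rightarrow> real) \<Rightarrow> real \<Rightarrow> real measure" where
  "prior_coord h s = distr (density lborel h) borel (\<lambda>z. s * z)"

text \<open>The unnormalised density in \<open>\<theta>\<close> of one coefficient given its observation \<open>x\<close>; the lemma
  \<open>posterior_coord_eq_Bayes\<close> below confirms that normalising it is Bayes' formula for the prior
  \<open>prior_coord h s\<close> and the likelihood of \<open>N(\<theta>, 1/n)\<close>.\<close>

definition posterior_weight :: "nat \<Rightarrow> (real \<Rightarrow> real) \<Rightarrow> real \<Rightarrow> real \<Rightarrow> real \<Rightarrow> real" where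
  "posterior_weight n h s x \<theta> = exp (- (real n * (x - \<theta>)\<^sup>2 / 2)) * h (\<theta> / s)"

definition posterior_coord :: "nat \<Rightarrow> (real \<Rightarrow> real) \<Rightarrow> real \<Rightarrow> real \<Rightarrow> real measure" where
  "posterior_coord n h s x =
     density lborel (\<lambda>\<theta>. posterior_weight n h s x \<theta> / (LBINT \<theta>'. posterior_weight n h s x \<theta>'))"

definition posterior ::
    "nat \<Rightarrow> (real \<Rightarrow> real) \<Rightarrow> (nat \<Rightarrow> real) \<Rightarrow> (nat \<times> nat \<Rightarrow> real) \<Rightarrow> (nat \<times> nat \<Rightarrow> real) measure" where
  "posterior n h s X = (\<Pi>\<^sub>M i\<in>wavelet_index. posterior_coord n h (s (fst i)) (X i))"

text \<open>No value is lost to the conventions for non-measurable sets and functions or non-integrable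
  functions: see \<open>sets_posterior_outside\<close> and \<open>measurable_posterior_outside\<close> below.\<close>

definition expected_posterior_outside ::
    "nat \<Rightarrow> (real \<Rightarrow> real) \<Rightarrow> (nat \<Rightarrow> real) \<Rightarrow> (nat \<times> nat \<Rightarrow> real) \<Rightarrow> real \<Rightarrow> real" where
  "expected_posterior_outside n h s f0 \<epsilon> =
     (LINT X | observation_law n f0.
        measure (posterior n h s X)
          {f \<in> space (posterior n h s X). L2_norm (\<lambda>i. f i - f0 i) > ennreal \<epsilon>})"

definition heavy_tailed_density :: "(real \<Rightarrow> real) \<Rightarrow> bool" where
  "heavy_tailed_density h \<longleftrightarrow>
     h \<in> borel_measurable borel \<and> (\<integral>\<^sup>+ x. ennreal (h x) \<partial>lborel) = 1 \<and>
     (\<forall>x. h (- x) = h x) \<and> (\<forall>x. h x > 0) \<and> bounded (range h) \<and> antimono_on {0..} h \<and>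
     (\<exists>c1>0. \<exists>\<kappa>\<ge>0. \<forall>x\<ge>0. ln (1 / h x) \<le> c1 * (1 + ln (1 + x) powr (1 + \<kappa>))) \<and>
     integrable lborel (\<lambda>x. x\<^sup>2 * h x)"


lemma heavy_tailed_densityD:
  assumes "heavy_tailed_density h"
  shows "h \<in> borel_measurable borel" "h x > 0" "integrable lborel h" "(LBINT x. h x) = 1"
    "prob_space (density lborel h)"
proof -
  show m[measurable]: "h \<in> borel_measurable borel" and p: "h x > 0" for x
    using assms by (auto simp: heavy_tailed_density_def)
  have "(\<integral>\<^sup>+ x. ennreal (h x) \<partial>lborel) = 1"
    using assms by (auto simp: heavy_tailed_density_def)
  then have "has_bochner_integral lborel h 1"
    by (intro has_bochner_integral_nn_integral) (auto simp: p less_imp_le)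
  then show "integrable lborel h" "(LBINT x. h x) = 1"
    by (auto simp: has_bochner_integral_iff)
  show "prob_space (density lborel h)"
    by (rule prob_spaceI) (simp add: emeasure_density \<open>(\<integral>\<^sup>+ x. ennreal (h x) \<partial>lborel) = 1\<close>)
qed

lemma prior_coord_eq_density:
  assumes "heavy_tailed_density h" and "s > 0"
  shows "prior_coord h s = density lborel (\<lambda>\<theta>. h (\<theta> / s) / s)"
proof -
  note [measurable] = heavy_tailed_densityD(1)[OF assms(1)]
  interpret prob_space "density lborel h" by (rule heavy_tailed_densityD(5)[OF assms(1)])
  have "distributed (density lborel h) lborel (\<lambda>z. z) h"
    by (auto simp: distributed_def distr_id2)
  then have "distributed (density lborel h) lborel (\<lambda>z. 0 + s * z) (\<lambda>\<theta>. ennreal (h ((\<theta> - 0) / s)) / ennreal \<bar>s\<bar>)"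
    using assms by (intro distributed_affine) (auto simp: distributed_def)
  then have "distr (density lborel h) lborel (\<lambda>z. 0 + s * z)
      = density lborel (\<lambda>\<theta>. ennreal (h ((\<theta> - 0) / s)) / ennreal \<bar>s\<bar>)"
    by (simp add: distributed_def)
  moreover have "distr (density lborel h) lborel (\<lambda>z. 0 + s * z) = prior_coord h s"
    unfolding prior_coord_def by (intro distr_cong) auto
  moreover have "ennreal (h ((\<theta> - 0) / s)) / ennreal \<bar>s\<bar> = ennreal (h (\<theta> / s) / s)" for \<theta>
    using assms heavy_tailed_densityD(2)[OF assms(1), of "\<theta> / s"] by (simp add: divide_ennreal)
  ultimately show ?thesis by simp
qed

lemma posterior_weight_integral:
  assumes "heavy_tailed_density h" and "s > 0"
  shows "integrable lborel (posterior_weight n h s x)" "(LBINT \<theta>. posterior_weight n h s x \<theta>) > 0"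
proof -
  note [measurable] = heavy_tailed_densityD(1)[OF assms(1)]
  have p: "h y > 0" for y by (rule heavy_tailed_densityD(2)[OF assms(1)])
  have "integrable lborel (\<lambda>\<theta>. h (0 + (1 / s) * \<theta>))"
    using assms heavy_tailed_densityD(3)[OF assms(1)] by (intro lborel_integrable_real_affine) auto
  then have i: "integrable lborel (\<lambda>\<theta>. h (\<theta> / s))" by simp
  show w: "integrable lborel (posterior_weight n h s x)"
    unfolding posterior_weight_def
    by (rule Bochner_Integration.integrable_bound[OF i])
       (auto simp: abs_mult p less_imp_le intro!: AE_I2 mult_left_le_one_le)
  have pos: "posterior_weight n h s x \<theta> > 0" for \<theta>
    by (simp add: posterior_weight_def p)
  have "(LBINT \<theta>. posterior_weight n h s x \<theta>) \<noteq> 0"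
  proof
    assume "(LBINT \<theta>. posterior_weight n h s x \<theta>) = 0"
    then have "AE \<theta> in lborel. posterior_weight n h s x \<theta> = 0"
      using integral_nonneg_eq_0_iff_AE[OF w] pos by (simp add: less_imp_le)
    then have "AE \<theta> in (lborel :: real measure). False"
      using pos by (auto elim!: eventually_mono simp: less_le)
    then show False by (simp add: eventually_False ae_filter_eq_bot_iff)
  qed
  moreover have "(LBINT \<theta>. posterior_weight n h s x \<theta>) \<ge> 0"
    using pos by (intro integral_nonneg_AE) (simp add: less_imp_le)
  ultimately show "(LBINT \<theta>. posterior_weight n h s x \<theta>) > 0" by simp
qed

lemma prob_space_posterior_coord:
  assumes "heavy_tailed_density h" and "s > 0"
  shows "prob_space (posterior_coord n h s x)"
proof (rule prob_spaceI)
  note w = posterior_weight_integral[OF assms, of n x]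
  have nn: "posterior_weight n h s x \<theta> / (LBINT \<theta>'. posterior_weight n h s x \<theta>') \<ge> 0" for \<theta>
    using w(2) heavy_tailed_densityD(2)[OF assms(1), of "\<theta> / s"]
    by (intro divide_nonneg_pos) (auto simp: posterior_weight_def)
  have "(\<integral>\<^sup>+ \<theta>. ennreal (posterior_weight n h s x \<theta> / (LBINT \<theta>'. posterior_weight n h s x \<theta>')) \<partial>lborel)
    = ennreal (LBINT \<theta>. posterior_weight n h s x \<theta> / (LBINT \<theta>'. posterior_weight n h s x \<theta>'))"
    using w(1) nn by (intro nn_integral_eq_integral) auto
  moreover have "(LBINT \<theta>. posterior_weight n h s x \<theta> / (LBINT \<theta>'. posterior_weight n h s x \<theta>')) = 1"
    using w by simp
  ultimately show "emeasure (posterior_coord n h s x) (space (posterior_coord n h s x)) = 1"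
    using borel_measurable_integrable[OF w(1)] by (simp add: posterior_coord_def emeasure_density)
qed

lemma posterior_coord_eq_Bayes:
  assumes "heavy_tailed_density h" and "s > 0" and "n > 0"
  defines "\<phi> \<equiv> \<lambda>\<theta> x. normal_density \<theta> (1 / sqrt (real n)) x"
  shows "posterior_coord n h s x =
    density (prior_coord h s) (\<lambda>\<theta>. \<phi> \<theta> x / (\<integral>\<theta>'. \<phi> \<theta>' x \<partial>prior_coord h s))"
proof -
  note [measurable] = heavy_tailed_densityD(1)[OF assms(1)]
  have p: "h y > 0" for y by (rule heavy_tailed_densityD(2)[OF assms(1)])
  define c where "c = sqrt (real n) / sqrt (2 * pi) / s"
  have c: "c > 0" using assms by (simp add: c_def)
  have \<phi>: "h (\<theta> / s) / s * \<phi> \<theta> x = c * posterior_weight n h s x \<theta>" for \<theta>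
    using assms by (simp add: \<phi>_def normal_density_def posterior_weight_def c_def
      power_divide real_sqrt_divide field_simps)
  have [measurable]: "(\<lambda>\<theta>. \<phi> \<theta> x) \<in> borel_measurable borel"
    unfolding \<phi>_def normal_density_def by measurable
  have "(\<integral>\<theta>'. \<phi> \<theta>' x \<partial>prior_coord h s) = (LBINT \<theta>. h (\<theta> / s) / s * \<phi> \<theta> x)"
    unfolding prior_coord_eq_density[OF assms(1,2)] using assms(2,3) p
    by (subst integral_density) (auto simp: less_imp_le)
  then have Z: "(\<integral>\<theta>'. \<phi> \<theta>' x \<partial>prior_coord h s) = c * (LBINT \<theta>. posterior_weight n h s x \<theta>)"
    unfolding \<phi> by simp
  have nn: "\<phi> \<theta> x / (c * (LBINT \<theta>. posterior_weight n h s x \<theta>)) \<ge> 0" for \<theta>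
    using c posterior_weight_integral(2)[OF assms(1,2), of n x]
    by (auto simp: \<phi>_def intro!: divide_nonneg_pos)
  show ?thesis
    unfolding Z unfolding prior_coord_eq_density[OF assms(1,2)] posterior_coord_def
  proof (subst density_density_eq, goal_cases)
    case 3
    have "ennreal (h (\<theta> / s) / s) * ennreal (\<phi> \<theta> x / (c * (LBINT \<theta>. posterior_weight n h s x \<theta>)))
      = ennreal (posterior_weight n h s x \<theta> / (LBINT \<theta>. posterior_weight n h s x \<theta>))" for \<theta>
      using \<phi>[of \<theta>] c p[of "\<theta> / s"] assms(2) nn[of \<theta>]
      by (simp add: ennreal_mult[symmetric] less_imp_le)
    then show ?case by simp
  qed auto
qed

lemma countable_wavelet_index: "countable wavelet_index"
  by (rule countableI_type)

lemma L2_norm_eq_SUP: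
  "L2_norm f = (SUP F\<in>{F. finite F \<and> F \<subseteq> wavelet_index}. ennreal (sqrt (\<Sum>i\<in>F. (f i)\<^sup>2)))"
    (is "_ = ?S")
proof (rule antisym)
  show "?S \<le> L2_norm f"
    unfolding L2_norm_def
    by (auto intro!: SUP_least ennreal_leI finite_sum_le_infsum)
  show "L2_norm f \<le> ?S"
  proof (cases "?S = \<infinity>")
    case True
    show ?thesis unfolding True by simp
  next
    case False
    then obtain c where c: "c \<ge> 0" "?S = ennreal c" by (cases ?S) auto
    have le: "(\<Sum>i\<in>F. (f i)\<^sup>2) \<le> c\<^sup>2" if "finite F" "F \<subseteq> wavelet_index" for F
    proof -
      have "ennreal (sqrt (\<Sum>i\<in>F. (f i)\<^sup>2)) \<le> ennreal c"
        unfolding c(2)[symmetric] using that by (intro SUP_upper) auto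
      then have "sqrt (\<Sum>i\<in>F. (f i)\<^sup>2) \<le> c" using c(1) by simp
      then show ?thesis by (simp add: sqrt_le_D)
    qed
    have "(\<lambda>i. (f i)\<^sup>2) summable_on wavelet_index"
      by (rule nonneg_bdd_above_summable_on) (auto intro!: bdd_aboveI2 le)
    moreover from this have "(\<Sum>\<^sub>\<infinity>i\<in>wavelet_index. (f i)\<^sup>2) \<le> c\<^sup>2"
      by (rule infsum_le_finite_sums) (use le in auto)
    ultimately show ?thesis
      using c by (simp add: L2_norm_def real_le_lsqrt ennreal_leI infsum_nonneg)
  qed
qed

lemma sets_posterior [measurable_cong]:
  "sets (posterior n h s X) = sets (\<Pi>\<^sub>M i\<in>wavelet_index. borel)"
  unfolding posterior_def posterior_coord_def by (intro sets_PiM_cong) auto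

lemma sets_observation_law [measurable_cong]:
  "sets (observation_law n f) = sets (\<Pi>\<^sub>M i\<in>wavelet_index. borel)"
  unfolding observation_law_def by (intro sets_PiM_cong) auto

lemma measurable_L2_norm_diff:
  "(\<lambda>f. L2_norm (\<lambda>i. f i - f0 i)) \<in> borel_measurable (\<Pi>\<^sub>M i\<in>wavelet_index. borel)"
  unfolding L2_norm_eq_SUP
proof (rule borel_measurable_SUP)
  show "countable {F. finite F \<and> F \<subseteq> wavelet_index}"
    using countable_Collect_finite_subset[OF countable_wavelet_index] by simp
  fix F assume "F \<in> {F. finite F \<and> F \<subseteq> wavelet_index}"
  then have [measurable]: "i \<in> F \<Longrightarrow> (\<lambda>f. f i) \<in> borel_measurable (\<Pi>\<^sub>M i\<in>wavelet_index. borel)" for i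
    by (intro measurable_component_singleton) auto
  show "(\<lambda>f. ennreal (sqrt (\<Sum>i\<in>F. (f i - f0 i)\<^sup>2))) \<in> borel_measurable (\<Pi>\<^sub>M i\<in>wavelet_index. borel)"
    by measurable
qed

lemma sets_posterior_outside:
  "{f \<in> space (posterior n h s X). L2_norm (\<lambda>i. f i - f0 i) > ennreal \<epsilon>} \<in> sets (posterior n h s X)"
proof -
  note [measurable] = measurable_L2_norm_diff[of f0]
  show ?thesis by measurable
qed

lemma prob_space_posterior:
  assumes "heavy_tailed_density h" and "\<And>l. s l > 0"
  shows "prob_space (posterior n h s X)"
  unfolding posterior_def by (intro prob_space_PiM prob_space_posterior_coord assms)

lemma prob_space_observation_law: "n > 0 \<Longrightarrow> prob_space (observation_law n f)"
  unfolding observation_law_def by (intro prob_space_PiM prob_space_normal_density) auto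

lemma measurable_posterior:
  assumes "heavy_tailed_density h" and "\<And>l. s l > 0"
  shows "posterior n h s \<in> (\<Pi>\<^sub>M i\<in>wavelet_index. borel) \<rightarrow>\<^sub>M prob_algebra (\<Pi>\<^sub>M i\<in>wavelet_index. borel)"
proof (rule measurable_prob_algebra_generated)
  let ?I = wavelet_index
  note [measurable] = heavy_tailed_densityD(1)[OF assms(1)]
  show "sets (\<Pi>\<^sub>M i\<in>?I. borel) = sigma_sets (\<Pi>\<^sub>E i\<in>?I. space borel) (prod_algebra ?I (\<lambda>_. borel :: real measure))"
    by (rule sets_PiM)
  show "Int_stable (prod_algebra ?I (\<lambda>_. borel :: real measure))"
    by (rule Int_stable_prod_algebra)
  show "prod_algebra ?I (\<lambda>_. borel :: real measure) \<subseteq> Pow (\<Pi>\<^sub>E i\<in>?I. space borel)"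
    by (rule prod_algebra_sets_into_space)
  show "prob_space (posterior n h s X)" for X by (rule prob_space_posterior[OF assms])
  show "sets (posterior n h s X) = sets (\<Pi>\<^sub>M i\<in>?I. borel)" for X by (rule sets_posterior)
  fix A assume "A \<in> prod_algebra ?I (\<lambda>_. borel :: real measure)"
  then obtain J E where A: "A = prod_emb ?I (\<lambda>_. borel) J (\<Pi>\<^sub>E j\<in>J. E j)"
    and J: "finite J" "J \<subseteq> ?I" and E: "\<And>i. i \<in> J \<Longrightarrow> E i \<in> sets (borel :: real measure)"
    by (elim prod_algebraE) auto
  have eq: "emeasure (posterior n h s X) A = (\<Prod>i\<in>J. emeasure (posterior_coord n h (s (fst i)) (X i)) (E i))" for X
  proof -
    have "A = prod_emb ?I (\<lambda>i. posterior_coord n h (s (fst i)) (X i)) J (\<Pi>\<^sub>E j\<in>J. E j)"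
      by (simp add: A prod_emb_def posterior_coord_def)
    then show ?thesis
      unfolding posterior_def using J E
      by (simp add: emeasure_PiM_emb prob_space_posterior_coord assms posterior_coord_def[THEN arg_cong[of _ _ sets]])
  qed
  have "(\<lambda>X. emeasure (posterior_coord n h (s (fst i)) (X i)) (E i)) \<in> borel_measurable (\<Pi>\<^sub>M i\<in>?I. borel)"
    if i: "i \<in> J" for i
  proof -
    note [measurable] = E[OF i]
    have "(\<lambda>x. \<integral>\<^sup>+ \<theta>. ennreal (posterior_weight n h (s (fst i)) x \<theta> /
        (LBINT \<theta>'. posterior_weight n h (s (fst i)) x \<theta>')) * indicator (E i) \<theta> \<partial>lborel) \<in> borel_measurable borel"
      unfolding posterior_weight_def by measurable
    also have "(\<lambda>x. \<integral>\<^sup>+ \<theta>. ennreal (posterior_weight n h (s (fst i)) x \<theta> /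
        (LBINT \<theta>'. posterior_weight n h (s (fst i)) x \<theta>')) * indicator (E i) \<theta> \<partial>lborel)
      = (\<lambda>x. emeasure (posterior_coord n h (s (fst i)) x) (E i))"
      unfolding posterior_coord_def posterior_weight_def by (subst emeasure_density) auto
    finally show ?thesis
      using i J by (intro measurable_compose[OF measurable_component_singleton]) auto
  qed
  then show "(\<lambda>X. emeasure (posterior n h s X) A) \<in> borel_measurable (\<Pi>\<^sub>M i\<in>?I. borel)"
    unfolding eq by (intro borel_measurable_prod_ennreal)
qed

lemma measurable_posterior_outside:
  assumes "heavy_tailed_density h" and "\<And>l. s l > 0"
  shows "(\<lambda>X. measure (posterior n h s X)
      {f \<in> space (posterior n h s X). L2_norm (\<lambda>i. f i - f0 i) > ennreal \<epsilon>})
    \<in> borel_measurable (observation_law n f0)"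
proof -
  note [measurable] = measurable_L2_norm_diff[of f0]
  let ?P = "\<Pi>\<^sub>M i\<in>wavelet_index. (borel :: real measure)"
  let ?B = "{f \<in> space ?P. L2_norm (\<lambda>i. f i - f0 i) > ennreal \<epsilon>}"
  have "?B \<in> sets ?P" by measurable
  then have "(\<lambda>M. measure M ?B) \<in> borel_measurable (subprob_algebra ?P)"
    unfolding measure_def by measurable
  from measurable_compose[OF measurable_prob_algebraD[OF measurable_posterior[OF assms]] this]
  have "(\<lambda>X. measure (posterior n h s X) ?B) \<in> borel_measurable ?P" .
  moreover have "space (posterior n h s X) = space ?P" for X
    by (rule sets_eq_imp_space_eq[OF sets_posterior])
  ultimately show ?thesis
    by (simp add: measurable_cong_sets[OF sets_observation_law refl])
qed

end

theory Submission
  imports Defs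
begin

text \<open>
  By Markov's inequality it suffices to bound the expected posterior second moment
  \<open>E \<integral> \<parallel>f - f0\<parallel>\<^sup>2 d\<Pi>(f | X)\<close>, which is a sum over coordinates.  With \<open>\<L>\<close> of the order of \<open>ln (1 / h (C / s\<^sub>l))\<close>,
  a coordinate contributes at most \<open>\<L> / n\<close>, because the heavy tail of \<open>h\<close> costs only the factor \<open>\<L>\<close> in
  the normalising constant, and also at most \<open>s\<^sub>l\<^sup>2 + \<L> min (1/n, f0\<^sub>l\<^sub>k\<^sup>2)\<close>, up to constants.  As \<open>\<L>\<close> is polynomial in \<open>l\<close>,
  the first bound on the levels \<open>l \<le> J\<close> and the second one on the levels \<open>l > J\<close>, with
  \<open>2\<^sup>J\<close> of the order of \<open>n powr (1 / (2\<beta> + 1))\<close>, give the rate up to logarithms; for \<open>r \<le> 2\<close> the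
  interpolation \<open>min (1/n, x\<^sup>2) \<le> n powr (r/2 - 1) * \<bar>x\<bar> powr r\<close> brings in the Besov norm.
\<close>

section \<open>Normalising constant and integrals of the posterior of one coefficient\<close>

lemma heavy_tailed_density_mono:
  assumes "heavy_tailed_density h" and "\<bar>x\<bar> \<le> y"
  shows "h y \<le> h x"
proof -
  have "h x = h \<bar>x\<bar>"
    using assms(1) by (cases "x \<ge> 0") (auto simp: heavy_tailed_density_def)
  moreover have "antimono_on {0..} h"
    using assms(1) by (simp add: heavy_tailed_density_def)
  then have "h y \<le> h \<bar>x\<bar>"
    using assms(2) by (auto simp: monotone_on_def)
  ultimately show ?thesis by simp
qed

text \<open>On an interval of length \<open>\<delta>\<close> next to \<open>\<mu>\<close>, the
  Gaussian weight loses at most the factor \<open>exp (- 1 / 2)\<close> against its value at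
  \<open>\<mu>\<close>, and monotonicity bounds \<open>h\<close> by its value at
  \<open>(\<bar>\<mu>\<bar> + \<delta>) / s\<close>. The centre is left free: it is the true
  coefficient, with \<open>\<delta> = 1 / sqrt n\<close>, in the bound of order 1/n, and 0, with
  \<open>\<delta> = s\<close>, in the comparison with the prior predictive law.\<close>

lemma posterior_weight_integral_ge:
  assumes h: "heavy_tailed_density h" and s: "s > 0"
    and \<delta>: "\<delta> > 0" "real n * \<delta>\<^sup>2 \<le> 1"
  shows "exp (- 1 / 2) * \<delta> * exp (- (real n * (x - \<mu>)\<^sup>2 / 2)) * h ((\<bar>\<mu>\<bar> + \<delta>) / s)
    \<le> (LBINT \<theta>. posterior_weight n h s x \<theta>)"
proof -
  define c where "c = exp (- 1 / 2) * exp (- (real n * (x - \<mu>)\<^sup>2 / 2)) * h ((\<bar>\<mu>\<bar> + \<delta>) / s)"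
  have hp: "h y > 0" for y by (rule heavy_tailed_densityD(2)[OF h])
  \<comment> \<open>The half of the interval around \<open>\<mu>\<close> on the side of \<open>x\<close>: there the cross term of the
    exponent is nonnegative.\<close>
  define a where "a = (if \<mu> \<le> x then \<mu> else \<mu> - \<delta>)"
  have a: "(x - \<mu>) * (\<theta> - \<mu>) \<ge> 0 \<and> \<bar>\<theta> - \<mu>\<bar> \<le> \<delta>" if "\<theta> \<in> {a..a + \<delta>}" for \<theta>
  proof (cases "\<mu> \<le> x")
    case True
    then show ?thesis using that by (auto simp: a_def)
  next
    case False
    then show ?thesis using that by (auto simp: a_def intro!: mult_nonpos_nonpos)
  qed
  have le: "c \<le> posterior_weight n h s x \<theta>" if t: "\<theta> \<in> {a..a + \<delta>}" for \<theta>
  proof -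
    have "(\<theta> - \<mu>)\<^sup>2 \<le> \<delta>\<^sup>2"
      using a[OF t] by (intro abs_le_square_iff[THEN iffD1]) auto
    then have "(x - \<theta>)\<^sup>2 \<le> (x - \<mu>)\<^sup>2 + \<delta>\<^sup>2"
      using a[OF t] by (simp add: power2_eq_square algebra_simps)
    then have "real n * (x - \<theta>)\<^sup>2 \<le> real n * (x - \<mu>)\<^sup>2 + real n * \<delta>\<^sup>2"
      by (metis distrib_left mult_left_mono of_nat_0_le_iff)
    then have "exp (- 1 / 2) * exp (- (real n * (x - \<mu>)\<^sup>2 / 2)) \<le> exp (- (real n * (x - \<theta>)\<^sup>2 / 2))"
      unfolding exp_add[symmetric] using \<delta>(2) by simp
    moreover have "h ((\<bar>\<mu>\<bar> + \<delta>) / s) \<le> h (\<theta> / s)"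
      using a[OF t] s by (intro heavy_tailed_density_mono[OF h]) (auto simp: abs_divide intro!: divide_right_mono)
    ultimately show ?thesis
      unfolding c_def posterior_weight_def using hp by (intro mult_mono) (auto intro: less_imp_le)
  qed
  have w: "posterior_weight n h s x \<theta> \<ge> 0" for \<theta>
    using hp[of "\<theta> / s"] by (simp add: posterior_weight_def)
  have "c * \<delta> = (LBINT \<theta>. indicator {a..a + \<delta>} \<theta> * c)"
    using \<delta>(1) by simp
  also have "\<dots> \<le> (LBINT \<theta>. posterior_weight n h s x \<theta>)"
    using le w by (intro integral_mono posterior_weight_integral[OF h s] integrable_mult_left
        integrable_real_indicator)
      (auto simp: emeasure_lborel_Icc_eq split: split_indicator)
  finally show ?thesis by (simp add: c_def mult_ac)
qed

lemma nn_integral_posterior_coord: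
  assumes h: "heavy_tailed_density h" and s: "s > 0"
    and g: "g \<in> borel_measurable borel" and g0: "\<And>\<theta>. g \<theta> \<ge> 0"
  shows "(\<integral>\<^sup>+ \<theta>. ennreal (g \<theta>) \<partial>posterior_coord n h s x) =
    (\<integral>\<^sup>+ \<theta>. ennreal (posterior_weight n h s x \<theta> * g \<theta>) \<partial>lborel) / ennreal (LBINT \<theta>. posterior_weight n h s x \<theta>)"
proof -
  note [measurable] = heavy_tailed_densityD(1)[OF h] g
  define Z where "Z = (LBINT \<theta>. posterior_weight n h s x \<theta>)"
  have Z: "Z > 0" unfolding Z_def by (rule posterior_weight_integral(2)[OF h s])
  have w: "posterior_weight n h s x \<theta> \<ge> 0" for \<theta>
    using heavy_tailed_densityD(2)[OF h, of "\<theta> / s"] by (simp add: posterior_weight_def)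
  have [measurable]: "posterior_weight n h s x \<in> borel_measurable borel"
    unfolding posterior_weight_def by measurable
  have "(\<integral>\<^sup>+ \<theta>. ennreal (g \<theta>) \<partial>posterior_coord n h s x) =
      (\<integral>\<^sup>+ \<theta>. ennreal (posterior_weight n h s x \<theta> / Z) * ennreal (g \<theta>) \<partial>lborel)"
    unfolding posterior_coord_def Z_def by (subst nn_integral_density) auto
  also have "\<dots> = (\<integral>\<^sup>+ \<theta>. ennreal (posterior_weight n h s x \<theta> * g \<theta>) / ennreal Z \<partial>lborel)"
    using Z w g0 by (intro nn_integral_cong)
      (simp add: divide_ennreal ennreal_mult[symmetric])
  finally show ?thesis
    unfolding Z_def[symmetric] by (simp add: nn_integral_divide)
qed

lemma borel_measurable_posterior_mse:
  assumes h: "heavy_tailed_density h" and s: "s > 0"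
  shows "(\<lambda>x. \<integral>\<^sup>+ \<theta>. ennreal ((\<theta> - \<theta>0)\<^sup>2) \<partial>posterior_coord n h s x) \<in> borel_measurable borel"
proof -
  note [measurable] = heavy_tailed_densityD(1)[OF h]
  have "(\<lambda>x. (\<integral>\<^sup>+ \<theta>. ennreal (posterior_weight n h s x \<theta> * (\<theta> - \<theta>0)\<^sup>2) \<partial>lborel)
      / ennreal (LBINT \<theta>. posterior_weight n h s x \<theta>)) \<in> borel_measurable borel"
    unfolding posterior_weight_def by measurable
  then show ?thesis by (subst nn_integral_posterior_coord[OF h s]) auto
qed

text \<open>Used with \<open>k\<close> equal to 0, 1 and 2, where the right-hand side is 1,
  \<open>\<sigma>\<^sup>2\<close> and three times the square of
  \<open>\<sigma>\<^sup>2\<close>.\<close>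

lemma nn_integral_normal_even_moment:
  assumes "\<sigma> > 0"
  shows "(\<integral>\<^sup>+ x. ennreal (normal_density \<mu> \<sigma> x * (x - \<mu>) ^ (2 * k)) \<partial>lborel)
    = ennreal (fact (2 * k) / ((2 / \<sigma>\<^sup>2) ^ k * fact k))"
  using normal_moment_even[OF assms, of \<mu> k] assms
  by (subst nn_integral_eq_integral) (auto simp: has_bochner_integral_iff)

section \<open>Risk of one coefficient: the bound of order 1/n up to a logarithmic factor\<close>

text \<open>In the numerator \<open>h\<close> is bounded by \<open>H\<close>, while the lower bound
  on the normalising constant carries the possibly tiny value \<open>q\<close>. Gaussian decay makes
  up for the ratio \<open>H / q\<close> as soon as \<open>(\<theta> - \<theta>0)\<^sup>2\<close>
  exceeds a threshold of order \<open>ln (H / q) / n\<close>, so a heavy tail costs only a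
  logarithm. The bound is pointwise in \<open>x\<close>.\<close>

lemma posterior_mse_le:
  fixes \<theta>0 :: real
  assumes h: "heavy_tailed_density h" and s: "s > 0" and n: "n > 0" and H: "\<And>y. h y \<le> H"
  shows "(\<integral>\<^sup>+ \<theta>. ennreal ((\<theta> - \<theta>0)\<^sup>2) \<partial>posterior_coord n h s x)
    \<le> ennreal (16 * (x - \<theta>0)\<^sup>2 +
        (8 * ln (H / h ((\<bar>\<theta>0\<bar> + 1 / sqrt n) / s)) + 4 * sqrt (8 * pi) * exp (1 / 2)) / n)"
proof -
  note [measurable] = heavy_tailed_densityD(1)[OF h]
  define q where "q = h ((\<bar>\<theta>0\<bar> + 1 / sqrt n) / s)"
  define b where "b = x - \<theta>0"
  \<comment> \<open>Chosen so that \<open>exp (- (n * M / 8)) = q / H\<close>: beyond the threshold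
    this factor trades the upper bound \<open>H\<close> for the \<open>q\<close> of the lower bound
    on \<open>Z\<close>.\<close>
  define M where "M = 8 * ln (H / q) / n"
  define K where "K = 4 * sqrt (8 * pi) * exp (1 / 2)"
  define Z where "Z = (LBINT \<theta>. posterior_weight n h s x \<theta>)"
  \<comment> \<open>The decay \<open>exp (- (n * u\<^sup>2 / 8))\<close> that remains in the tail is
    that of a normal density of variance \<open>4 / n\<close>.\<close>
  define \<sigma> where "\<sigma> = 2 / sqrt n"
  have \<sigma>: "\<sigma> > 0" "\<sigma>\<^sup>2 = 4 / n" using n by (auto simp: \<sigma>_def power_divide)
  have Z: "Z > 0" unfolding Z_def by (rule posterior_weight_integral(2)[OF h s])
  have hp: "h y > 0" for y by (rule heavy_tailed_densityD(2)[OF h])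
  have q: "q > 0" "q \<le> H" and Hp: "H > 0" using hp H less_le_trans[OF hp H] by (auto simp: q_def)
  have M: "M \<ge> 0" using q by (auto simp: M_def)
  have eM: "exp (- (n * M / 8)) = q / H"
    using n q Hp by (simp add: M_def exp_minus)
  have Zge: "exp (- 1 / 2) * (1 / sqrt n) * exp (- (n * b\<^sup>2 / 2)) * q \<le> Z"
    unfolding Z_def q_def b_def using n
    by (intro posterior_weight_integral_ge[OF h s]) (auto simp: power_divide)
  \<comment> \<open>The tail weight is at most \<open>C\<close> times
    \<open>normal_density \<theta>0 \<sigma>\<close>. The factors \<open>q\<close> and
    \<open>exp (- (n * b\<^sup>2 / 2))\<close> also occur in \<open>Zge\<close> and cancel in the
    quotient by \<open>Z\<close>.\<close>
  define C where "C = q * exp (- (n * b\<^sup>2 / 2)) * sqrt (2 * pi * \<sigma>\<^sup>2)"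
  have C: "C \<ge> 0" using q by (simp add: C_def)
  have w: "posterior_weight n h s x \<theta> \<ge> 0" for \<theta>
    using hp[of "\<theta> / s"] by (simp add: posterior_weight_def)
  have pw: "posterior_weight n h s x \<theta> * (\<theta> - \<theta>0)\<^sup>2 \<le>
      (16 * b\<^sup>2 + M) * posterior_weight n h s x \<theta> + C * (normal_density \<theta>0 \<sigma> \<theta> * (\<theta> - \<theta>0)\<^sup>2)" for \<theta>
  proof (cases "(\<theta> - \<theta>0)\<^sup>2 \<le> 16 * b\<^sup>2 + M")
    case True
    then have "posterior_weight n h s x \<theta> * (\<theta> - \<theta>0)\<^sup>2 \<le> (16 * b\<^sup>2 + M) * posterior_weight n h s x \<theta>"
      using w[of \<theta>] by (metis mult.commute mult_right_mono)
    moreover have "C * (normal_density \<theta>0 \<sigma> \<theta> * (\<theta> - \<theta>0)\<^sup>2) \<ge> 0" using C by simp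
    ultimately show ?thesis by linarith
  next
    case False
    define u where "u = \<theta> - \<theta>0"
    \<comment> \<open>Past the threshold \<open>\<bar>b\<bar>\<close> is at most a quarter of
      \<open>\<bar>u\<bar>\<close>, so the cross term of \<open>(x - \<theta>)\<^sup>2\<close> uses
      up at most half of \<open>u\<^sup>2\<close>; the other half is shared equally between
      \<open>M\<close> and the Gaussian in \<open>u\<close>.\<close>
    have u: "u\<^sup>2 \<ge> 16 * b\<^sup>2" "u\<^sup>2 \<ge> M" using False M by (auto simp: u_def intro: order_trans[of _ "16 * b\<^sup>2 + M"])
    then have "(4 * b)\<^sup>2 \<le> u\<^sup>2" by (simp add: power_mult_distrib)
    then have "\<bar>4 * b\<bar> \<le> \<bar>u\<bar>" by (simp only: abs_le_square_iff)
    then have "4 * \<bar>b\<bar> * \<bar>u\<bar> \<le> \<bar>u\<bar> * \<bar>u\<bar>" by (intro mult_right_mono) auto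
    then have bu: "4 * (b * u) \<le> u\<^sup>2"
      using abs_ge_self[of "b * u"] by (simp add: abs_mult power2_eq_square)
    have "(x - \<theta>)\<^sup>2 = b\<^sup>2 - 2 * (b * u) + u\<^sup>2"
      by (simp add: b_def u_def power2_eq_square algebra_simps)
    then have "(x - \<theta>)\<^sup>2 \<ge> b\<^sup>2 + M / 4 + u\<^sup>2 / 4"
      using bu u by linarith
    then have "real n * (x - \<theta>)\<^sup>2 \<ge> real n * (b\<^sup>2 + M / 4 + u\<^sup>2 / 4)"
      by (intro mult_left_mono) auto
    then have "exp (- (real n * (x - \<theta>)\<^sup>2 / 2)) \<le>
        exp (- (n * b\<^sup>2 / 2)) * exp (- (n * M / 8)) * exp (- (n * u\<^sup>2 / 8))"
      unfolding exp_add[symmetric] by (simp add: algebra_simps)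
    then have "posterior_weight n h s x \<theta> \<le>
        (exp (- (n * b\<^sup>2 / 2)) * exp (- (n * M / 8)) * exp (- (n * u\<^sup>2 / 8))) * H"
      unfolding posterior_weight_def using H hp by (intro mult_mono) (auto intro: less_imp_le)
    also have "\<dots> = C * normal_density \<theta>0 \<sigma> \<theta>"
      using Hp n \<sigma> by (simp add: eM C_def normal_density_def u_def)
    finally have "posterior_weight n h s x \<theta> * u\<^sup>2 \<le> C * normal_density \<theta>0 \<sigma> \<theta> * u\<^sup>2"
      by (intro mult_right_mono) auto
    moreover have "(16 * b\<^sup>2 + M) * posterior_weight n h s x \<theta> \<ge> 0" using M w by simp
    ultimately show ?thesis by (simp add: u_def)
  qed
  have [measurable]: "posterior_weight n h s x \<in> borel_measurable borel"
    unfolding posterior_weight_def by measurable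
  have "(\<integral>\<^sup>+ \<theta>. ennreal (posterior_weight n h s x \<theta> * (\<theta> - \<theta>0)\<^sup>2) \<partial>lborel)
    \<le> (\<integral>\<^sup>+ \<theta>. ennreal (16 * b\<^sup>2 + M) * ennreal (posterior_weight n h s x \<theta>)
        + ennreal C * ennreal (normal_density \<theta>0 \<sigma> \<theta> * (\<theta> - \<theta>0)\<^sup>2) \<partial>lborel)"
    using pw w M C by (intro nn_integral_mono)
      (simp add: ennreal_mult[symmetric] ennreal_plus[symmetric] del: ennreal_plus)
  also have "\<dots> = ennreal (16 * b\<^sup>2 + M) * (\<integral>\<^sup>+ \<theta>. ennreal (posterior_weight n h s x \<theta>) \<partial>lborel)
        + ennreal C * (\<integral>\<^sup>+ \<theta>. ennreal (normal_density \<theta>0 \<sigma> \<theta> * (\<theta> - \<theta>0)\<^sup>2) \<partial>lborel)"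
    by (simp add: nn_integral_add nn_integral_cmult)
  also have "(\<integral>\<^sup>+ \<theta>. ennreal (posterior_weight n h s x \<theta>) \<partial>lborel) = ennreal Z"
    unfolding Z_def using w by (intro nn_integral_eq_integral posterior_weight_integral[OF h s]) auto
  also have "(\<integral>\<^sup>+ \<theta>. ennreal (normal_density \<theta>0 \<sigma> \<theta> * (\<theta> - \<theta>0)\<^sup>2) \<partial>lborel) = ennreal (\<sigma>\<^sup>2)"
    using nn_integral_normal_even_moment[OF \<sigma>(1), of \<theta>0 1] \<sigma>(1) by (simp add: numeral_2_eq_2)
  finally have "(\<integral>\<^sup>+ \<theta>. ennreal (posterior_weight n h s x \<theta> * (\<theta> - \<theta>0)\<^sup>2) \<partial>lborel)
      \<le> ennreal ((16 * b\<^sup>2 + M) * Z + C * \<sigma>\<^sup>2)"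
    using Z M C by (simp add: ennreal_mult[symmetric] ennreal_plus[symmetric] del: ennreal_plus)
  then have "(\<integral>\<^sup>+ \<theta>. ennreal (posterior_weight n h s x \<theta> * (\<theta> - \<theta>0)\<^sup>2) \<partial>lborel) / ennreal Z
      \<le> ennreal ((16 * b\<^sup>2 + M) * Z + C * \<sigma>\<^sup>2) / ennreal Z"
    by (rule divide_right_mono_ennreal)
  also have "\<dots> = ennreal ((16 * b\<^sup>2 + M) + C * \<sigma>\<^sup>2 / Z)"
    using Z M C by (subst divide_ennreal) (simp_all add: add_divide_distrib del: ennreal_plus)
  also have "\<dots> \<le> ennreal (16 * b\<^sup>2 + (8 * ln (H / q) + K) / n)"
  proof (rule ennreal_leI)
    have eq: "C * \<sigma>\<^sup>2 = (exp (- 1 / 2) * (1 / sqrt n) * exp (- (n * b\<^sup>2 / 2)) * q) * (K / n)"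
    proof -
      have "sqrt (2 * pi * \<sigma>\<^sup>2) = sqrt (8 * pi) / sqrt n"
        using n by (simp add: \<sigma> real_sqrt_divide[symmetric])
      moreover have "exp (- 1 / 2 :: real) * exp (1 / 2) = 1" by (simp add: exp_add[symmetric])
      ultimately show ?thesis by (simp add: C_def K_def \<sigma>)
    qed
    have "C * \<sigma>\<^sup>2 \<le> Z * (K / n)"
      unfolding eq by (intro mult_right_mono[OF Zge]) (simp add: K_def)
    then have "C * \<sigma>\<^sup>2 / Z \<le> K / n" using Z by (simp only: pos_divide_le_eq mult.commute)
    then show "16 * b\<^sup>2 + M + C * \<sigma>\<^sup>2 / Z \<le> 16 * b\<^sup>2 + (8 * ln (H / q) + K) / n"
      by (simp add: M_def add_divide_distrib)
  qed
  finally show ?thesis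
    by (subst nn_integral_posterior_coord[OF h s]) (auto simp: Z_def b_def q_def K_def)
qed

text \<open>The leading 1 in \<open>\<L>\<close> absorbs the additive constant of the pointwise
  bound. Averaging over the observation, whose variance is \<open>1 / n\<close>, turns
  \<open>16 * (x - \<theta>0)\<^sup>2\<close> into \<open>16 / n\<close>.\<close>

lemma nn_integral_posterior_mse_le:
  fixes \<theta>0 :: real
  assumes h: "heavy_tailed_density h" and s: "s > 0" and n: "n > 0" and H: "\<And>y. h y \<le> H"
  defines "K \<equiv> 8 + 4 * sqrt (8 * pi) * exp (1 / 2)"
    and "\<L> \<equiv> 1 + ln (H / h ((\<bar>\<theta>0\<bar> + 1 / sqrt n) / s))"
  shows "(\<integral>\<^sup>+ \<theta>. ennreal ((\<theta> - \<theta>0)\<^sup>2) \<partial>posterior_coord n h s x) \<le> ennreal (16 * (x - \<theta>0)\<^sup>2 + K * \<L> / n)"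
    and "(\<integral>\<^sup>+ x. (\<integral>\<^sup>+ \<theta>. ennreal ((\<theta> - \<theta>0)\<^sup>2) \<partial>posterior_coord n h s x)
            \<partial>density lborel (normal_density \<theta>0 (1 / sqrt n))) \<le> ennreal ((16 + K) * \<L> / n)"
    and "\<L> \<ge> 1"
proof -
  have hp: "h y > 0" for y by (rule heavy_tailed_densityD(2)[OF h])
  have K: "K \<ge> 8" by (simp add: K_def)
  show L: "\<L> \<ge> 1" using H hp by (simp add: \<L>_def)
  show le: "(\<integral>\<^sup>+ \<theta>. ennreal ((\<theta> - \<theta>0)\<^sup>2) \<partial>posterior_coord n h s x) \<le> ennreal (16 * (x - \<theta>0)\<^sup>2 + K * \<L> / n)" for x
  proof (rule order_trans[OF posterior_mse_le[OF h s n H] ennreal_leI])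
    have "8 * ln (H / h ((\<bar>\<theta>0\<bar> + 1 / sqrt n) / s)) + (K - 8) \<le> 8 * \<L> + (K - 8) * \<L>"
      using L K mult_left_mono[of 1 \<L> "K - 8"] by (intro add_mono) (auto simp: \<L>_def)
    also have "\<dots> = K * \<L>" by (simp add: algebra_simps)
    finally show "16 * (x - \<theta>0)\<^sup>2 + (8 * ln (H / h ((\<bar>\<theta>0\<bar> + 1 / sqrt n) / s)) + 4 * sqrt (8 * pi) * exp (1 / 2)) / n
        \<le> 16 * (x - \<theta>0)\<^sup>2 + K * \<L> / n"
      using n by (intro add_left_mono divide_right_mono) (auto simp: K_def)
  qed
  let ?p = "normal_density \<theta>0 (1 / sqrt n)"
  have "(\<integral>\<^sup>+ x. (\<integral>\<^sup>+ \<theta>. ennreal ((\<theta> - \<theta>0)\<^sup>2) \<partial>posterior_coord n h s x) \<partial>density lborel ?p)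
      \<le> (\<integral>\<^sup>+ x. ennreal (16 * (x - \<theta>0)\<^sup>2 + K * \<L> / n) \<partial>density lborel ?p)"
    by (intro nn_integral_mono le)
  also have "\<dots> = (\<integral>\<^sup>+ x. ennreal 16 * ennreal (?p x * (x - \<theta>0) ^ (2 * 1)) +
      ennreal (K * \<L> / n) * ennreal (?p x * (x - \<theta>0) ^ (2 * 0)) \<partial>lborel)"
  proof -
    have "ennreal p * ennreal (16 * b\<^sup>2 + K * \<L> / n) =
        ennreal 16 * ennreal (p * b ^ (2 * 1)) + ennreal (K * \<L> / n) * ennreal (p * b ^ (2 * 0))"
      if "p \<ge> 0" for p b :: real
      using K L that by (simp add: ennreal_mult[symmetric] ennreal_plus[symmetric] distrib_left mult_ac
        del: ennreal_plus ennreal_numeral)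
    then show ?thesis by (subst nn_integral_density) auto
  qed
  also have "\<dots> = ennreal 16 * ennreal (1 / n) + ennreal (K * \<L> / n) * ennreal 1"
    using n nn_integral_normal_even_moment[of "1 / sqrt n" \<theta>0 0] nn_integral_normal_even_moment[of "1 / sqrt n" \<theta>0 1]
    by (subst nn_integral_add) (auto simp: nn_integral_cmult power_divide)
  also have "\<dots> = ennreal (16 * 1 / n + K * \<L> / n)"
    using K L n by (simp add: ennreal_mult[symmetric] ennreal_plus[symmetric] del: ennreal_plus ennreal_numeral)
  also have "\<dots> \<le> ennreal ((16 + K) * \<L> / n)"
    using K L n by (intro ennreal_leI) (simp add: add_divide_distrib[symmetric] divide_right_mono distrib_right)
  finally show "(\<integral>\<^sup>+ x. (\<integral>\<^sup>+ \<theta>. ennreal ((\<theta> - \<theta>0)\<^sup>2) \<partial>posterior_coord n h s x) \<partial>density lborel ?p)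
    \<le> ennreal ((16 + K) * \<L> / n)" .
qed

section \<open>Risk of one coefficient: small signals\<close>

text \<open>The prior density of the coefficient is \<open>h (\<theta> / s) / s\<close>; leaving out
  the normalisation \<open>1 / s\<close> turns a second moment of order \<open>s\<^sup>2\<close>
  into one of order \<open>s ^ 3\<close>.\<close>

lemma nn_integral_scaled_second_moment:
  assumes h: "heavy_tailed_density h" and s: "s > 0"
  shows "(\<integral>\<^sup>+ \<theta>. ennreal (h (\<theta> / s) * \<theta>\<^sup>2) \<partial>lborel) = ennreal (s ^ 3 * (LBINT x. x\<^sup>2 * h x))"
proof -
  note [measurable] = heavy_tailed_densityD(1)[OF h]
  have hp: "h y > 0" for y by (rule heavy_tailed_densityD(2)[OF h])
  have m: "(LBINT x. x\<^sup>2 * h x) \<ge> 0"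
    using hp by (intro Bochner_Integration.integral_nonneg) (simp add: less_imp_le)
  have "(\<integral>\<^sup>+ \<theta>. ennreal (h (\<theta> / s) * \<theta>\<^sup>2) \<partial>lborel)
      = \<bar>s\<bar> * (\<integral>\<^sup>+ x. ennreal (h ((0 + s * x) / s) * (0 + s * x)\<^sup>2) \<partial>lborel)"
    using s by (intro nn_integral_real_affine) auto
  also have "\<dots> = ennreal s * (\<integral>\<^sup>+ x. ennreal (s\<^sup>2) * ennreal (x\<^sup>2 * h x) \<partial>lborel)"
    using s hp by (auto intro!: arg_cong2[of _ _ _ _ "(*)"] nn_integral_cong
      simp: ennreal_mult[symmetric] less_imp_le power_mult_distrib mult_ac)
  also have "\<dots> = ennreal s * (ennreal (s\<^sup>2) * ennreal (LBINT x. x\<^sup>2 * h x))"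
    using h hp by (subst nn_integral_cmult, simp, subst nn_integral_eq_integral)
      (auto simp: heavy_tailed_density_def less_imp_le)
  also have "\<dots> = ennreal (s ^ 3 * (LBINT x. x\<^sup>2 * h x))"
  proof -
    have eq: "s ^ 3 * (LBINT x. x\<^sup>2 * h x) = s * (s\<^sup>2 * (LBINT x. x\<^sup>2 * h x))"
      by (simp only: power2_eq_square power3_eq_cube mult.assoc)
    show ?thesis unfolding eq using s m by (simp add: ennreal_mult)
  qed
  finally show ?thesis .
qed

text \<open>When \<open>n \<bar>x \<theta>0\<bar>\<close> is at most 1, the law of the observation is dominated by a multiple of the
  prior predictive density, under which the posterior second moment averages to the prior one.
  Markov's inequality takes care of the other observations.\<close>

lemma nn_integral_posterior_mse_small_signal:
  fixes \<theta>0 :: real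
  assumes h: "heavy_tailed_density h" and s: "s > 0" and n: "n > 0" and H: "\<And>y. h y \<le> H"
    and ns: "n * s\<^sup>2 \<le> 1" and nt: "n * \<theta>0\<^sup>2 \<le> 1 / 2"
  defines "K \<equiv> 8 + 4 * sqrt (8 * pi) * exp (1 / 2)"
    and "\<L> \<equiv> 1 + ln (H / h ((\<bar>\<theta>0\<bar> + 1 / sqrt n) / s))"
  shows "(\<integral>\<^sup>+ x. (\<integral>\<^sup>+ \<theta>. ennreal ((\<theta> - \<theta>0)\<^sup>2) \<partial>posterior_coord n h s x)
            \<partial>density lborel (normal_density \<theta>0 (1 / sqrt n)))
    \<le> ennreal (2 * exp (3 / 2) / h 1 * (LBINT x. x\<^sup>2 * h x) * s\<^sup>2 + (194 + 4 * K) * \<L> * \<theta>0\<^sup>2)"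
proof -
  note [measurable] = heavy_tailed_densityD(1)[OF h]
  let ?V = "\<lambda>x. \<integral>\<^sup>+ \<theta>. ennreal ((\<theta> - \<theta>0)\<^sup>2) \<partial>posterior_coord n h s x"
  define p where "p = normal_density \<theta>0 (1 / sqrt n)"
  \<comment> \<open>Up to the normalising constant of the normal density, this will bound
    \<open>2 * p x / Z\<close>: the 2 comes from the square of a sum, \<open>exp 1\<close> from the
    comparison of two normal densities, and \<open>exp (1 / 2) / (s * h 1)\<close> from the lower
    bound on \<open>Z\<close>.\<close>
  define a where "a = 2 * exp (3 / 2) / (s * h 1)"
  define m where "m = (LBINT x. x\<^sup>2 * h x)"
  \<comment> \<open>Apart from a factor \<open>1 / s\<close>, the joint density of coefficient and
    observation integrated against \<open>\<theta>\<^sup>2\<close> over the coefficient.\<close>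
  define G where "G x = (\<integral>\<^sup>+ \<theta>. ennreal (normal_density \<theta> (1 / sqrt n) x) * ennreal (h (\<theta> / s) * \<theta>\<^sup>2) \<partial>lborel)" for x
  have hp: "h y > 0" for y by (rule heavy_tailed_densityD(2)[OF h])
  have K: "K \<ge> 8" by (simp add: K_def)
  have L: "\<L> \<ge> 1" unfolding \<L>_def by (rule nn_integral_posterior_mse_le(3)[OF h s n H])
  have a: "a \<ge> 0" using s hp by (simp add: a_def less_imp_le)
  have m: "m \<ge> 0" unfolding m_def using hp by (intro Bochner_Integration.integral_nonneg) (auto simp: less_imp_le)
  have p0: "p x \<ge> 0" for x by (simp add: p_def)
  have [measurable]: "p \<in> borel_measurable borel" by (simp add: p_def)
  have Gm [measurable]: "G \<in> borel_measurable borel"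
    unfolding G_def normal_density_def by measurable
  \<comment> \<open>The first two terms dominate when
    \<open>n * \<bar>x * \<theta>0\<bar> \<le> 1\<close>, the last two otherwise. Each of the four
    integrates to a multiple of \<open>s\<^sup>2\<close>, \<open>\<theta>0\<^sup>2\<close> or
    \<open>\<L> * \<theta>0\<^sup>2\<close>.\<close>
  have pw: "ennreal (p x) * ?V x \<le> ennreal (2 * \<theta>0\<^sup>2) * ennreal (p x) + ennreal a * G x
      + ennreal (64 * n\<^sup>2 * \<theta>0\<^sup>2) * ennreal (p x * (x - \<theta>0) ^ (2 * 2))
      + ennreal (4 * K * \<L> * n * \<theta>0\<^sup>2) * ennreal (p x * (x - \<theta>0) ^ (2 * 1))" (is "_ \<le> ?A + ?B + ?C + ?D") for x
  proof (cases "n * \<bar>x * \<theta>0\<bar> \<le> 1")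
    case True
    interpret P: prob_space "posterior_coord n h s x" by (rule prob_space_posterior_coord[OF h s])
    define Z where "Z = (LBINT \<theta>. posterior_weight n h s x \<theta>)"
    have Z: "Z > 0" unfolding Z_def by (rule posterior_weight_integral(2)[OF h s])
    have sp: "sets (posterior_coord n h s x) = sets borel" by (simp add: posterior_coord_def)
    note [measurable_cong] = sp
    have "?V x \<le> (\<integral>\<^sup>+ \<theta>. ennreal (2 * \<theta>0\<^sup>2) + ennreal 2 * ennreal (\<theta>\<^sup>2) \<partial>posterior_coord n h s x)"
    proof (intro nn_integral_mono)
      fix \<theta> :: real
      have "(\<theta> - \<theta>0)\<^sup>2 + (\<theta> + \<theta>0)\<^sup>2 = 2 * \<theta>0\<^sup>2 + 2 * \<theta>\<^sup>2" by (simp add: power2_eq_square algebra_simps)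
      then have "(\<theta> - \<theta>0)\<^sup>2 \<le> 2 * \<theta>0\<^sup>2 + 2 * \<theta>\<^sup>2"
        by (metis le_add_same_cancel1 zero_le_power2)
      then have "ennreal ((\<theta> - \<theta>0)\<^sup>2) \<le> ennreal (2 * \<theta>0\<^sup>2 + 2 * \<theta>\<^sup>2)" by (rule ennreal_leI)
      then show "ennreal ((\<theta> - \<theta>0)\<^sup>2) \<le> ennreal (2 * \<theta>0\<^sup>2) + ennreal 2 * ennreal (\<theta>\<^sup>2)"
        by (subst (asm) ennreal_plus) (simp_all add: ennreal_mult)
    qed
    also have "\<dots> = ennreal (2 * \<theta>0\<^sup>2) + ennreal 2 * (\<integral>\<^sup>+ \<theta>. ennreal (\<theta>\<^sup>2) \<partial>posterior_coord n h s x)"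
      by (subst nn_integral_add) (auto simp: nn_integral_cmult P.emeasure_space_1)
    also have "(\<integral>\<^sup>+ \<theta>. ennreal (\<theta>\<^sup>2) \<partial>posterior_coord n h s x)
        = (\<integral>\<^sup>+ \<theta>. ennreal (posterior_weight n h s x \<theta> * \<theta>\<^sup>2) \<partial>lborel) / ennreal Z"
      unfolding Z_def by (intro nn_integral_posterior_coord[OF h s]) auto
    finally have V: "?V x \<le> ennreal (2 * \<theta>0\<^sup>2) + ennreal 2 * ((\<integral>\<^sup>+ \<theta>. ennreal (posterior_weight n h s x \<theta> * \<theta>\<^sup>2) \<partial>lborel) / ennreal Z)"
      (is "_ \<le> _ + _ * (?F / _)") .
    define c where "c = sqrt n / sqrt (2 * pi)"
    have c: "c > 0" using n by (simp add: c_def)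
    have nd: "normal_density \<theta> (1 / sqrt n) x = c * exp (- (n * (x - \<theta>)\<^sup>2 / 2))" for \<theta>
      using n by (simp add: normal_density_def c_def power_divide real_sqrt_divide)
    have G: "G x = ennreal c * ?F"
      unfolding G_def using c hp by (subst nn_integral_cmult[symmetric])
        (auto simp: nd posterior_weight_def ennreal_mult[symmetric] less_imp_le mult_ac intro!: nn_integral_cong)
    \<comment> \<open>For such \<open>x\<close> the normal density with mean
      \<open>\<theta>0\<close> is at most \<open>exp 1\<close> times the one with mean 0.\<close>
    have "- (n * (x - \<theta>0)\<^sup>2 / 2) \<le> 1 + - (n * x\<^sup>2 / 2)"
    proof -
      have "- (n * (x - \<theta>0)\<^sup>2 / 2) = - (n * x\<^sup>2 / 2) + n * (x * \<theta>0) - n * \<theta>0\<^sup>2 / 2"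
        by (simp add: power2_eq_square field_simps)
      moreover have "n * (x * \<theta>0) \<le> n * \<bar>x * \<theta>0\<bar>" by (intro mult_left_mono) auto
      moreover have "n * \<theta>0\<^sup>2 / 2 \<ge> 0" by simp
      ultimately show ?thesis using True by linarith
    qed
    then have px: "p x \<le> c * (exp 1 * exp (- (n * x\<^sup>2 / 2)))"
      unfolding p_def nd exp_add[symmetric] using c by simp
    \<comment> \<open>An interval of length \<open>s\<close> next to 0 is admissible by
      \<open>ns\<close>, and the prior density is then evaluated at 1 whatever \<open>s\<close>
      is.\<close>
    have "exp (- 1 / 2) * s * exp (- (real n * (x - 0)\<^sup>2 / 2)) * h ((\<bar>0\<bar> + s) / s) \<le> Z"
      unfolding Z_def using s ns by (intro posterior_weight_integral_ge[OF h s]) auto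
    then have Zge: "exp (- 1 / 2) * s * exp (- (n * x\<^sup>2 / 2)) * h 1 \<le> Z"
      using s by simp
    have "2 * p x \<le> 2 * (c * (exp 1 * exp (- (n * x\<^sup>2 / 2))))" using px by simp
    also have "\<dots> = a * c * (exp (- 1 / 2) * s * exp (- (n * x\<^sup>2 / 2)) * h 1)"
    proof -
      have "exp (3 / 2) * exp (- 1 / 2) = exp (1::real)" by (simp add: exp_add[symmetric])
      then show ?thesis using s hp[of 1] by (simp add: a_def field_simps)
    qed
    also have "\<dots> \<le> a * c * Z" using a c Zge by (intro mult_left_mono) auto
    finally have "2 * p x / Z \<le> a * c" using Z by (simp add: divide_simps)
    then have pZ: "ennreal (p x) * ennreal 2 / ennreal Z \<le> ennreal a * ennreal c"
      using Z p0[of x] a c by (simp add: ennreal_mult[symmetric] divide_ennreal mult_ac del: ennreal_numeral)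
    have "ennreal (p x) * ?V x \<le> ennreal (p x) * (ennreal (2 * \<theta>0\<^sup>2) + ennreal 2 * (?F / ennreal Z))"
      by (intro mult_left_mono V) auto
    also have "\<dots> = ?A + (ennreal (p x) * ennreal 2 / ennreal Z) * ?F"
      by (simp add: distrib_left ennreal_times_divide mult_ac)
         (simp add: divide_ennreal_def mult_ac)
    also have "\<dots> \<le> ?A + (ennreal a * ennreal c) * ?F"
      by (intro add_left_mono mult_right_mono pZ) auto
    also have "\<dots> = ?A + ?B" by (simp add: G mult_ac)
    also have "\<dots> \<le> ?A + ?B + ?C + ?D" by (simp add: add.assoc)
    finally show ?thesis .
  next
    case False
    define b where "b = x - \<theta>0"
    have "n * \<bar>x * \<theta>0\<bar> = n * \<bar>\<theta>0 * \<theta>0 + b * \<theta>0\<bar>" by (simp add: b_def algebra_simps)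
    also have "\<dots> \<le> n * (\<bar>\<theta>0 * \<theta>0\<bar> + \<bar>b * \<theta>0\<bar>)" by (intro mult_left_mono abs_triangle_ineq) auto
    also have "\<dots> = n * \<theta>0\<^sup>2 + n * \<bar>b * \<theta>0\<bar>" by (simp add: power2_eq_square distrib_left)
    \<comment> \<open>As \<open>n * \<theta>0\<^sup>2\<close> is at most one half, the noise
      \<open>b\<close> has to supply the other half. Squaring gives a factor that is at least 1 and
      proportional to \<open>\<theta>0\<^sup>2\<close>; multiplying the pointwise bound by it is the
      Markov step.\<close>
    finally have "1 \<le> 2 * (n * \<bar>b * \<theta>0\<bar>)" using False nt by linarith
    then have "1\<^sup>2 \<le> (2 * (n * \<bar>b * \<theta>0\<bar>))\<^sup>2" by (intro power_mono) auto
    then have one: "1 \<le> 4 * n\<^sup>2 * \<theta>0\<^sup>2 * b\<^sup>2" by (simp add: power_mult_distrib mult_ac)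
    have "16 * b\<^sup>2 + K * \<L> / n \<le> (16 * b\<^sup>2 + K * \<L> / n) * (4 * n\<^sup>2 * \<theta>0\<^sup>2 * b\<^sup>2)"
      using one K L n mult_left_mono[OF one, of "16 * b\<^sup>2 + K * \<L> / n"] by simp
    also have "\<dots> = 64 * n\<^sup>2 * \<theta>0\<^sup>2 * b ^ (2 * 2) + 4 * K * \<L> * n * \<theta>0\<^sup>2 * b ^ (2 * 1)"
      using n by (simp add: power2_eq_square power4_eq_xxxx field_simps)
    finally have le: "16 * b\<^sup>2 + K * \<L> / n \<le> 64 * n\<^sup>2 * \<theta>0\<^sup>2 * b ^ (2 * 2) + 4 * K * \<L> * n * \<theta>0\<^sup>2 * b ^ (2 * 1)" .
    have "ennreal (p x) * ?V x \<le> ennreal (p x) * ennreal (16 * b\<^sup>2 + K * \<L> / n)"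
      unfolding K_def \<L>_def b_def by (intro mult_left_mono nn_integral_posterior_mse_le(1)[OF h s n H]) auto
    also have "\<dots> \<le> ennreal (p x) * ennreal (64 * n\<^sup>2 * \<theta>0\<^sup>2 * b ^ (2 * 2) + 4 * K * \<L> * n * \<theta>0\<^sup>2 * b ^ (2 * 1))"
      by (intro mult_left_mono ennreal_leI le) auto
    also have "\<dots> = ?C + ?D"
      unfolding b_def[symmetric] using p0[of x] K L
      by (simp add: ennreal_mult[symmetric] ennreal_plus[symmetric] distrib_left mult_ac del: ennreal_plus)
    also have "\<dots> \<le> (?A + ?B) + (?C + ?D)" by simp
    finally show ?thesis by (simp only: add.assoc)
  qed
  have Vm: "?V \<in> borel_measurable borel" by (rule borel_measurable_posterior_mse[OF h s])
  have IG: "(\<integral>\<^sup>+ x. G x \<partial>lborel) = ennreal (s ^ 3 * m)"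
  proof -
    \<comment> \<open>Integrating out the observation first removes the normal density and leaves
      the second moment of the unnormalised prior.\<close>
    have "(\<integral>\<^sup>+ x. G x \<partial>lborel) = (\<integral>\<^sup>+ \<theta>. (\<integral>\<^sup>+ x. ennreal (normal_density \<theta> (1 / sqrt n) x) * ennreal (h (\<theta> / s) * \<theta>\<^sup>2) \<partial>lborel) \<partial>lborel)"
      unfolding G_def normal_density_def by (rule lborel_pair.Fubini') measurable
    also have "\<dots> = (\<integral>\<^sup>+ \<theta>. ennreal (h (\<theta> / s) * \<theta>\<^sup>2) \<partial>lborel)"
    proof (rule nn_integral_cong)
      fix \<theta> :: real
      show "(\<integral>\<^sup>+ x. ennreal (normal_density \<theta> (1 / sqrt n) x) * ennreal (h (\<theta> / s) * \<theta>\<^sup>2) \<partial>lborel) = ennreal (h (\<theta> / s) * \<theta>\<^sup>2)"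
        using nn_integral_normal_even_moment[of "1 / sqrt n" \<theta> 0] n by (simp add: nn_integral_multc)
    qed
    also have "\<dots> = ennreal (s ^ 3 * m)" unfolding m_def by (rule nn_integral_scaled_second_moment[OF h s])
    finally show ?thesis .
  qed
  have "(\<integral>\<^sup>+ x. ?V x \<partial>density lborel p) = (\<integral>\<^sup>+ x. ennreal (p x) * ?V x \<partial>lborel)"
    using Vm by (subst nn_integral_density) auto
  also have "\<dots> \<le> (\<integral>\<^sup>+ x. ennreal (2 * \<theta>0\<^sup>2) * ennreal (p x) + ennreal a * G x
      + ennreal (64 * n\<^sup>2 * \<theta>0\<^sup>2) * ennreal (p x * (x - \<theta>0) ^ (2 * 2))
      + ennreal (4 * K * \<L> * n * \<theta>0\<^sup>2) * ennreal (p x * (x - \<theta>0) ^ (2 * 1)) \<partial>lborel)"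
    by (rule nn_integral_mono) (rule pw)
  also have "\<dots> = ennreal (2 * \<theta>0\<^sup>2) * (\<integral>\<^sup>+ x. ennreal (p x) \<partial>lborel) + ennreal a * (\<integral>\<^sup>+ x. G x \<partial>lborel)
      + ennreal (64 * n\<^sup>2 * \<theta>0\<^sup>2) * (\<integral>\<^sup>+ x. ennreal (p x * (x - \<theta>0) ^ (2 * 2)) \<partial>lborel)
      + ennreal (4 * K * \<L> * n * \<theta>0\<^sup>2) * (\<integral>\<^sup>+ x. ennreal (p x * (x - \<theta>0) ^ (2 * 1)) \<partial>lborel)"
    by (simp add: nn_integral_add nn_integral_cmult)
  also have "\<dots> = ennreal (2 * \<theta>0\<^sup>2) * ennreal 1 + ennreal a * ennreal (s ^ 3 * m)
      + ennreal (64 * n\<^sup>2 * \<theta>0\<^sup>2) * ennreal (3 / n\<^sup>2)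
      + ennreal (4 * K * \<L> * n * \<theta>0\<^sup>2) * ennreal (1 / n)"
  proof -
    have \<delta>: "1 / sqrt n > 0" using n by simp
    have "(\<integral>\<^sup>+ x. ennreal (p x) \<partial>lborel) = ennreal 1"
      using nn_integral_normal_even_moment[OF \<delta>, of \<theta>0 0] by (simp add: p_def)
    moreover have "(\<integral>\<^sup>+ x. ennreal (p x * (x - \<theta>0) ^ (2 * 1)) \<partial>lborel) = ennreal (1 / n)"
      unfolding p_def nn_integral_normal_even_moment[OF \<delta>] using n by (simp add: power_divide)
    moreover have "(\<integral>\<^sup>+ x. ennreal (p x * (x - \<theta>0) ^ (2 * 2)) \<partial>lborel) = ennreal (3 / n\<^sup>2)"
      unfolding p_def nn_integral_normal_even_moment[OF \<delta>] using n by (simp add: power_divide fact_numeral power_mult_distrib)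
    ultimately show ?thesis using IG by simp
  qed
  also have "\<dots> = ennreal (2 * \<theta>0\<^sup>2 * 1 + a * (s ^ 3 * m) + 64 * n\<^sup>2 * \<theta>0\<^sup>2 * (3 / n\<^sup>2) + 4 * K * \<L> * n * \<theta>0\<^sup>2 * (1 / n))"
    using a s m K L by (simp add: ennreal_mult[symmetric] ennreal_plus[symmetric] del: ennreal_plus)
  also have "\<dots> \<le> ennreal (2 * exp (3 / 2) / h 1 * m * s\<^sup>2 + (194 + 4 * K) * \<L> * \<theta>0\<^sup>2)"
  proof (rule ennreal_leI)
    have "a * (s ^ 3 * m) = 2 * exp (3 / 2) / h 1 * m * s\<^sup>2"
      using s by (simp add: a_def power2_eq_square power3_eq_cube)
    \<comment> \<open>The constant 194 collects 2 from the first term and 64 times 3 from the fourth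
      moment of the noise.\<close>
    moreover have "194 * \<theta>0\<^sup>2 \<le> 194 * \<theta>0\<^sup>2 * \<L>" using mult_left_mono[OF L, of "194 * \<theta>0\<^sup>2"] by simp
    ultimately show "2 * \<theta>0\<^sup>2 * 1 + a * (s ^ 3 * m) + 64 * n\<^sup>2 * \<theta>0\<^sup>2 * (3 / n\<^sup>2) + 4 * K * \<L> * n * \<theta>0\<^sup>2 * (1 / n)
      \<le> 2 * exp (3 / 2) / h 1 * m * s\<^sup>2 + (194 + 4 * K) * \<L> * \<theta>0\<^sup>2"
      using n by (simp add: algebra_simps)
  qed
  finally show ?thesis by (simp add: p_def m_def)
qed

section \<open>Risk of one coefficient: both bounds combined\<close>

text \<open>For the second argument of the outer minimum there are three regimes. If
  \<open>n * \<theta>0\<^sup>2 > 1 / 2\<close>, then \<open>min (1 / n) (\<theta>0\<^sup>2)\<close>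
  is at least half of \<open>1 / n\<close> and the general bound suffices. If
  \<open>n * \<theta>0\<^sup>2 \<le> 1 / 2\<close> and \<open>n * s\<^sup>2 \<le> 1\<close>, the
  small signal bound applies. If \<open>n * \<theta>0\<^sup>2 \<le> 1 / 2\<close> but
  \<open>n * s\<^sup>2 > 1\<close>, the prior is so wide that \<open>h\<close> is evaluated at an
  argument of at most 2; the logarithmic factor is then bounded by a constant and
  \<open>1 / n\<close> by \<open>s\<^sup>2\<close>.\<close>

lemma coordinate_risk_bound:
  assumes h: "heavy_tailed_density h" and H: "\<And>y. h y \<le> H"
  shows "\<exists>C>0. \<forall>n s \<theta>0. n > 0 \<longrightarrow> s > 0 \<longrightarrow>
    (\<integral>\<^sup>+ x. (\<integral>\<^sup>+ \<theta>. ennreal ((\<theta> - \<theta>0)\<^sup>2) \<partial>posterior_coord n h s x)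
        \<partial>density lborel (normal_density \<theta>0 (1 / sqrt n)))
      \<le> ennreal (C * min ((1 + ln (H / h ((\<bar>\<theta>0\<bar> + 1 / sqrt n) / s))) / n)
          (s\<^sup>2 + (1 + ln (H / h ((\<bar>\<theta>0\<bar> + 1 / sqrt n) / s))) * min (1 / n) (\<theta>0\<^sup>2)))"
proof -
  define K where "K = 8 + 4 * sqrt (8 * pi) * exp (1 / 2)"
  define m where "m = (LBINT x. x\<^sup>2 * h x)"
  define L2 where "L2 = 1 + ln (H / h 2)"
  define C where "C = (194 + 4 * K) * L2 + 2 * exp (3 / 2) / h 1 * m"
  have hp: "h y > 0" for y by (rule heavy_tailed_densityD(2)[OF h])
  have Hp: "H > 0" using hp H by (rule less_le_trans)
  have K: "K \<ge> 8" by (simp add: K_def)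
  have L2: "L2 \<ge> 1" using H hp by (simp add: L2_def)
  have m: "m \<ge> 0" unfolding m_def using hp by (intro Bochner_Integration.integral_nonneg) (auto simp: less_imp_le)
  have m': "2 * exp (3 / 2) / h 1 * m \<ge> 0" using m hp by (simp add: less_imp_le)
  have KL: "194 + 4 * K \<le> (194 + 4 * K) * L2"
    using mult_left_mono[OF L2, of "194 + 4 * K"] K by (simp only: mult_1_right)
  have C2: "C \<ge> (194 + 4 * K) * L2"
    unfolding C_def using m' by (rule add_increasing2) simp
  have C3: "C \<ge> 2 * exp (3 / 2) / h 1 * m"
    unfolding C_def using K L2 by (intro add_increasing) auto
  note C = order_trans[OF KL C2] C2 C3
  show ?thesis
  proof (intro exI[of _ C] conjI allI impI)
    show "C > 0" using C(1) K by linarith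
    fix n :: nat and s \<theta>0 :: real
    assume n: "n > 0" and s: "s > 0"
    define \<L> where "\<L> = 1 + ln (H / h ((\<bar>\<theta>0\<bar> + 1 / sqrt n) / s))"
    define R where "R = (\<integral>\<^sup>+ x. (\<integral>\<^sup>+ \<theta>. ennreal ((\<theta> - \<theta>0)\<^sup>2) \<partial>posterior_coord n h s x)
        \<partial>density lborel (normal_density \<theta>0 (1 / sqrt n)))"
    have L: "\<L> \<ge> 1" unfolding \<L>_def by (rule nn_integral_posterior_mse_le(3)[OF h s n H])
    have R1: "R \<le> ennreal ((16 + K) * \<L> / n)"
      unfolding R_def \<L>_def K_def by (rule nn_integral_posterior_mse_le(2)[OF h s n H])
    have "(16 + K) * (\<L> / n) \<le> C * (\<L> / n)"
      using C(1) K L by (intro mult_right_mono) auto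
    then have R2: "R \<le> ennreal (C * (\<L> / n))"
      by (intro order_trans[OF R1] ennreal_leI) simp
    have "R \<le> ennreal (C * (s\<^sup>2 + \<L> * min (1 / n) (\<theta>0\<^sup>2)))"
    proof (cases "n * \<theta>0\<^sup>2 \<le> 1 / 2")
      case False
      then have "1 / n \<le> 2 * min (1 / n) (\<theta>0\<^sup>2)" using n by (auto simp: min_def field_simps)
      then have "(16 + K) * \<L> * (1 / n) \<le> (16 + K) * \<L> * (2 * min (1 / n) (\<theta>0\<^sup>2))"
        using K L by (intro mult_left_mono) auto
      also have "\<dots> = (32 + 2 * K) * (\<L> * min (1 / n) (\<theta>0\<^sup>2))" by (simp add: algebra_simps)
      also have "\<dots> \<le> C * (s\<^sup>2 + \<L> * min (1 / n) (\<theta>0\<^sup>2))"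
        using C(1) K L by (intro mult_mono) auto
      finally show ?thesis by (intro order_trans[OF R1] ennreal_leI) simp
    next
      case nt: True
      show ?thesis
      proof (cases "n * s\<^sup>2 \<le> 1")
        case True
        have "\<theta>0\<^sup>2 \<le> 1 / n" using nt n by (simp add: field_simps)
        then have mn: "min (1 / n) (\<theta>0\<^sup>2) = \<theta>0\<^sup>2" by simp
        have "2 * exp (3 / 2) / h 1 * m * s\<^sup>2 + (194 + 4 * K) * (\<L> * \<theta>0\<^sup>2) \<le> C * s\<^sup>2 + C * (\<L> * \<theta>0\<^sup>2)"
          using C L by (intro add_mono mult_right_mono) auto
        then have le: "2 * exp (3 / 2) / h 1 * m * s\<^sup>2 + (194 + 4 * K) * \<L> * \<theta>0\<^sup>2 \<le> C * (s\<^sup>2 + \<L> * min (1 / n) (\<theta>0\<^sup>2))"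
          unfolding mn by (simp add: algebra_simps)
        have "R \<le> ennreal (2 * exp (3 / 2) / h 1 * m * s\<^sup>2 + (194 + 4 * K) * \<L> * \<theta>0\<^sup>2)"
          unfolding R_def \<L>_def K_def m_def by (rule nn_integral_posterior_mse_small_signal[OF h s n H True nt])
        then show ?thesis by (rule order_trans[OF _ ennreal_leI[OF le]])
      next
        case False
        then have sn: "1 / n \<le> s\<^sup>2" using n by (simp add: field_simps)
        have "sqrt (1 / n) \<le> s" using sn s by (intro real_le_lsqrt) auto
        moreover have "\<bar>\<theta>0\<bar> \<le> sqrt (1 / n)"
          using nt n by (intro real_le_rsqrt) (simp add: field_simps)
        ultimately have "(\<bar>\<theta>0\<bar> + 1 / sqrt n) / s \<le> 2" using s by (simp add: real_sqrt_divide field_simps)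
        then have "h 2 \<le> h ((\<bar>\<theta>0\<bar> + 1 / sqrt n) / s)"
          using s by (intro heavy_tailed_density_mono[OF h]) auto
        then have "\<L> \<le> L2"
          unfolding \<L>_def L2_def using hp Hp by (simp add: frac_le)
        then have "(16 + K) * \<L> * (1 / n) \<le> (16 + K) * L2 * s\<^sup>2"
          using sn K L L2 by (intro mult_mono) auto
        also have "\<dots> \<le> (194 + 4 * K) * L2 * s\<^sup>2" using K L2 by (intro mult_right_mono) auto
        also have "\<dots> \<le> C * (s\<^sup>2 + \<L> * min (1 / n) (\<theta>0\<^sup>2))"
          using C K L L2 by (intro mult_mono) auto
        finally show ?thesis by (intro order_trans[OF R1] ennreal_leI) simp
      qed
    qed
    then show "R \<le> ennreal (C * min (\<L> / n) (s\<^sup>2 + \<L> * min (1 / n) (\<theta>0\<^sup>2)))"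
      using R2 by (cases "\<L> / n \<le> s\<^sup>2 + \<L> * min (1 / n) (\<theta>0\<^sup>2)") (simp_all only: min_def if_True if_False)
  qed
qed

section \<open>From single coefficients to the norm of the whole sequence\<close>

lemma nn_integral_PiM_component:
  assumes M: "\<And>i. i \<in> I \<Longrightarrow> prob_space (M i)" and i: "i \<in> I" and f: "f \<in> borel_measurable (M i)"
  shows "(\<integral>\<^sup>+ X. f (X i) \<partial>Pi\<^sub>M I M) = (\<integral>\<^sup>+ x. f x \<partial>M i)"
proof -
  have "(\<integral>\<^sup>+ x. f x \<partial>M i) = (\<integral>\<^sup>+ x. f x \<partial>distr (Pi\<^sub>M I M) (M i) (\<lambda>X. X i))"
    by (subst distr_PiM_component[OF M i]) auto
  also have "\<dots> = (\<integral>\<^sup>+ X. f (X i) \<partial>Pi\<^sub>M I M)"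
    using i f by (intro nn_integral_distr) auto
  finally show ?thesis by simp
qed

text \<open>The norm is a supremum over finite sets of indices, and a finite set on which
  \<open>\<epsilon>\<close> is exceeded lies within finitely many levels. The series in
  \<open>ennreal\<close> always has a value, so an infinite norm is covered, and it can be
  integrated term by term.\<close>

lemma L2_norm_gt_imp_level_sum:
  assumes "L2_norm g > ennreal \<epsilon>" and "\<epsilon> > 0"
  shows "ennreal (\<epsilon>\<^sup>2) \<le> (\<Sum>l. \<Sum>k<2 ^ l. ennreal ((g (l, k))\<^sup>2))"
proof -
  obtain F where F: "finite F" "F \<subseteq> wavelet_index" "ennreal \<epsilon> < ennreal (sqrt (\<Sum>i\<in>F. (g i)\<^sup>2))"
    using assms(1) unfolding L2_norm_eq_SUP less_SUP_iff by auto
  from F(3) have "\<epsilon> < sqrt (\<Sum>i\<in>F. (g i)\<^sup>2)"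
    using assms(2) by (simp add: ennreal_less_iff)
  then have "\<epsilon>\<^sup>2 \<le> (sqrt (\<Sum>i\<in>F. (g i)\<^sup>2))\<^sup>2"
    using assms(2) by (intro power_mono) auto
  then have le: "\<epsilon>\<^sup>2 \<le> (\<Sum>i\<in>F. (g i)\<^sup>2)" by (simp add: sum_nonneg)
  obtain N where "\<forall>l\<in>fst ` F. l < N" using F(1) by (metis finite_imageI finite_nat_set_iff_bounded)
  then have sub: "F \<subseteq> (SIGMA l:{..<N}. {..<2 ^ l})"
    using F(2) by (fastforce simp: wavelet_index_def)
  have "\<epsilon>\<^sup>2 \<le> (\<Sum>i\<in>(SIGMA l:{..<N}. {..<2 ^ l}). (g i)\<^sup>2)"
    by (rule order_trans[OF le sum_mono2[OF _ sub]]) auto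
  also have "\<dots> = (\<Sum>l<N. \<Sum>k<2 ^ l. (g (l, k))\<^sup>2)" by (subst sum.Sigma) auto
  finally have "ennreal (\<epsilon>\<^sup>2) \<le> ennreal (\<Sum>l<N. \<Sum>k<2 ^ l. (g (l, k))\<^sup>2)" by (rule ennreal_leI)
  also have "\<dots> = (\<Sum>l<N. \<Sum>k<2 ^ l. ennreal ((g (l, k))\<^sup>2))"
    by (subst sum_ennreal[symmetric]) (auto intro!: sum_nonneg)
  also have "\<dots> \<le> (\<Sum>l. \<Sum>k<2 ^ l. ennreal ((g (l, k))\<^sup>2))"
    by (intro sum_le_suminf summableI) auto
  finally show ?thesis .
qed

text \<open>Markov's inequality for the squared norm under the posterior, averaged over the data.
  All terms are nonnegative, so sums and integrals may be exchanged; each term then depends on a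
  single coordinate, whose marginal is \<open>posterior_coord\<close> under the posterior and a
  normal law under the observation law.\<close>

lemma expected_posterior_outside_le:
  assumes h: "heavy_tailed_density h" and s: "\<And>l. s l > 0" and n: "n > 0" and \<epsilon>: "\<epsilon> > 0" and B: "B \<ge> 0"
    and le: "(\<Sum>l. \<Sum>k<2 ^ l. \<integral>\<^sup>+ x. (\<integral>\<^sup>+ \<theta>. ennreal ((\<theta> - f0 (l, k))\<^sup>2) \<partial>posterior_coord n h (s l) x)
        \<partial>density lborel (normal_density (f0 (l, k)) (1 / sqrt n))) \<le> ennreal B"
  shows "expected_posterior_outside n h s f0 \<epsilon> \<le> B / \<epsilon>\<^sup>2"
proof -
  note [measurable] = heavy_tailed_densityD(1)[OF h]
  let ?S = "\<lambda>X. {f \<in> space (posterior n h s X). L2_norm (\<lambda>i. f i - f0 i) > ennreal \<epsilon>}"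
  let ?V = "\<lambda>l k x. \<integral>\<^sup>+ \<theta>. ennreal ((\<theta> - f0 (l, k))\<^sup>2) \<partial>posterior_coord n h (s l) x"
  have Vm: "?V l k \<in> borel_measurable borel" for l k by (rule borel_measurable_posterior_mse[OF h s])
  have X: "ennreal (\<epsilon>\<^sup>2) * ennreal (measure (posterior n h s X) (?S X)) \<le> (\<Sum>l. \<Sum>k<2 ^ l. ?V l k (X (l, k)))" for X
  proof -
    interpret P: prob_space "posterior n h s X" by (rule prob_space_posterior[OF h s])
    have comp: "(\<lambda>f. ennreal ((f (l, k) - f0 (l, k))\<^sup>2)) \<in> borel_measurable (posterior n h s X)"
      if "k < 2 ^ l" for l k
    proof -
      have [measurable]: "(\<lambda>f. f (l, k)) \<in> borel_measurable (\<Pi>\<^sub>M i\<in>wavelet_index. borel)"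
        using that by (intro measurable_component_singleton) (auto simp: wavelet_index_def)
      show ?thesis by measurable
    qed
    have "ennreal (\<epsilon>\<^sup>2) * emeasure (posterior n h s X) (?S X) =
        (\<integral>\<^sup>+ f. ennreal (\<epsilon>\<^sup>2) * indicator (?S X) f \<partial>posterior n h s X)"
      by (subst nn_integral_cmult_indicator[OF sets_posterior_outside]) simp
    also have "\<dots> \<le> (\<integral>\<^sup>+ f. (\<Sum>l. \<Sum>k<2 ^ l. ennreal ((f (l, k) - f0 (l, k))\<^sup>2)) \<partial>posterior n h s X)"
      using L2_norm_gt_imp_level_sum[of \<epsilon> "\<lambda>i. _ i - f0 i"] \<epsilon>
      by (intro nn_integral_mono) (auto split: split_indicator)
    also have "\<dots> = (\<Sum>l. \<integral>\<^sup>+ f. (\<Sum>k<2 ^ l. ennreal ((f (l, k) - f0 (l, k))\<^sup>2)) \<partial>posterior n h s X)"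
      by (intro nn_integral_suminf borel_measurable_sum comp) auto
    also have "\<dots> = (\<Sum>l. \<Sum>k<2 ^ l. \<integral>\<^sup>+ f. ennreal ((f (l, k) - f0 (l, k))\<^sup>2) \<partial>posterior n h s X)"
      by (intro suminf_cong nn_integral_sum comp) auto
    also have "\<dots> = (\<Sum>l. \<Sum>k<2 ^ l. ?V l k (X (l, k)))"
    proof (intro suminf_cong sum.cong refl)
      fix l k :: nat assume "k \<in> {..<2 ^ l}"
      then have i: "(l, k) \<in> wavelet_index" by (auto simp: wavelet_index_def)
      have "(\<lambda>\<theta>. ennreal ((\<theta> - f0 (l, k))\<^sup>2)) \<in> borel_measurable (posterior_coord n h (s l) (X (l, k)))"
        by (simp add: posterior_coord_def)
      then show "(\<integral>\<^sup>+ f. ennreal ((f (l, k) - f0 (l, k))\<^sup>2) \<partial>posterior n h s X) = ?V l k (X (l, k))"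
        unfolding posterior_def using i
        by (subst nn_integral_PiM_component[where i="(l, k)" and f="\<lambda>\<theta>. ennreal ((\<theta> - f0 (l, k))\<^sup>2)"])
          (auto intro!: prob_space_posterior_coord[OF h s])
    qed
    finally show ?thesis by (simp add: P.emeasure_eq_measure)
  qed
  have Vc: "(\<lambda>X. ?V l k (X (l, k))) \<in> borel_measurable (observation_law n f0)" if "k < 2 ^ l" for l k
  proof -
    have "(\<lambda>X. X (l, k)) \<in> borel_measurable (\<Pi>\<^sub>M i\<in>wavelet_index. borel)"
      using that by (intro measurable_component_singleton) (auto simp: wavelet_index_def)
    from measurable_compose[OF this Vm] show ?thesis
      by (simp add: measurable_cong_sets[OF sets_observation_law refl])
  qed
  have obs: "(\<integral>\<^sup>+ X. ?V l k (X (l, k)) \<partial>observation_law n f0) =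
      (\<integral>\<^sup>+ x. ?V l k x \<partial>density lborel (normal_density (f0 (l, k)) (1 / sqrt n)))" if "k < 2 ^ l" for l k
    unfolding observation_law_def
    using that n Vm[of l k] by (subst nn_integral_PiM_component[where i="(l, k)" and f="?V l k"])
      (auto simp: wavelet_index_def intro!: prob_space_normal_density)
  have m: "(\<lambda>X. measure (posterior n h s X) (?S X)) \<in> borel_measurable (observation_law n f0)"
    by (rule measurable_posterior_outside[OF h s])
  let ?E = "\<integral>\<^sup>+ X. ennreal (measure (posterior n h s X) (?S X)) \<partial>observation_law n f0"
  have "ennreal (\<epsilon>\<^sup>2) * ?E =
      (\<integral>\<^sup>+ X. ennreal (\<epsilon>\<^sup>2) * ennreal (measure (posterior n h s X) (?S X)) \<partial>observation_law n f0)"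
    using m by (intro nn_integral_cmult[symmetric]) simp
  also have "\<dots> \<le> (\<integral>\<^sup>+ X. (\<Sum>l. \<Sum>k<2 ^ l. ?V l k (X (l, k))) \<partial>observation_law n f0)"
    by (intro nn_integral_mono X)
  also have "\<dots> = (\<Sum>l. \<integral>\<^sup>+ X. (\<Sum>k<2 ^ l. ?V l k (X (l, k))) \<partial>observation_law n f0)"
    by (intro nn_integral_suminf borel_measurable_sum Vc) auto
  also have "\<dots> = (\<Sum>l. \<Sum>k<2 ^ l. \<integral>\<^sup>+ X. ?V l k (X (l, k)) \<partial>observation_law n f0)"
    by (intro suminf_cong nn_integral_sum Vc) auto
  also have "\<dots> \<le> ennreal B" using le by (simp add: obs)
  finally have "ennreal (\<epsilon>\<^sup>2) * ?E \<le> ennreal B" .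
  then have "?E * ennreal (\<epsilon>\<^sup>2) / ennreal (\<epsilon>\<^sup>2) \<le> ennreal B / ennreal (\<epsilon>\<^sup>2)"
    by (intro divide_right_mono_ennreal) (simp add: mult.commute)
  moreover have "?E * ennreal (\<epsilon>\<^sup>2) / ennreal (\<epsilon>\<^sup>2) = ?E"
    using \<epsilon> by (intro ennreal_mult_divide_eq) auto
  ultimately have "?E \<le> ennreal (B / \<epsilon>\<^sup>2)"
    using \<epsilon> B by (simp add: divide_ennreal)
  then show ?thesis
    unfolding expected_posterior_outside_def using m \<epsilon> B
    by (subst integral_eq_nn_integral) (auto intro!: enn2real_leI)
qed

section \<open>Besov balls, geometric tails and the logarithmic factor\<close>

lemma besov_ball_level:
  assumes f: "f \<in> besov_ball \<beta> r L"
  shows "(\<Sum>k<2 ^ l. \<bar>f (l, k)\<bar> powr r) \<le> L powr r * 2 powr (- (r * (\<beta> + 1/2 - 1/r) * real l))"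
proof -
  let ?T = "\<lambda>l. 2 powr (r * real l * (\<beta> + 1/2 - 1/r)) * (\<Sum>k<2 ^ l. \<bar>f (l, k)\<bar> powr r)"
  have T: "?T l \<ge> 0" for l by (intro mult_nonneg_nonneg sum_nonneg) auto
  have "sum ?T {l} \<le> suminf ?T"
    using f T by (intro sum_le_suminf) (auto simp: besov_ball_def)
  then have "?T l \<le> suminf ?T" by simp
  also have "\<dots> \<le> L powr r" using f by (simp add: besov_ball_def)
  finally have le: "?T l \<le> L powr r" .
  have "(\<Sum>k<2 ^ l. \<bar>f (l, k)\<bar> powr r) = ?T l * 2 powr (- (r * real l * (\<beta> + 1/2 - 1/r)))"
    by (simp add: powr_minus)
  also have "\<dots> \<le> L powr r * 2 powr (- (r * real l * (\<beta> + 1/2 - 1/r)))"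
    by (intro mult_right_mono le) auto
  finally show ?thesis by (simp only: mult_ac)
qed

text \<open>The condition \<open>\<beta> > 1/r - 1/2\<close> makes the level weights of the ball at
  least 1, so a coefficient is bounded by the radius. This uniform bound controls the argument of
  \<open>h\<close> in the logarithmic factor.\<close>

lemma besov_ball_coefficient_le:
  assumes f: "f \<in> besov_ball \<beta> r L" and "L > 0" "r \<ge> 1" "\<beta> > 1/r - 1/2" and k: "k < 2 ^ l"
  shows "\<bar>f (l, k)\<bar> \<le> L"
proof -
  have "\<bar>f (l, k)\<bar> powr r \<le> (\<Sum>k<2 ^ l. \<bar>f (l, k)\<bar> powr r)"
    using k by (intro member_le_sum) auto
  also have "\<dots> \<le> L powr r * 2 powr (- (r * (\<beta> + 1/2 - 1/r) * real l))"
    by (rule besov_ball_level[OF f])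
  also have "\<dots> \<le> L powr r * 2 powr 0"
    using assms by (intro mult_left_mono powr_mono) auto
  finally have "\<bar>f (l, k)\<bar> powr r \<le> L powr r" by simp
  moreover have "L powr r < \<bar>f (l, k)\<bar> powr r" if "L < \<bar>f (l, k)\<bar>"
    using that assms by (intro powr_less_mono2) auto
  ultimately show ?thesis by fastforce
qed

text \<open>The tail of a polynomial times a geometric sequence is comparable to its first term.
  Uniformity in \<open>J\<close> comes from
  \<open>1 + real (m + Suc J) \<le> (1 + real J) * (2 + real m)\<close>, which separates the
  variables and leaves the same convergent series for every \<open>J\<close>.\<close>

lemma tail_sum_le:
  fixes c :: real
  assumes c: "c > 0"
  shows "\<exists>G>0. \<forall>J. (\<Sum>m. ennreal ((1 + real (m + Suc J)) ^ P * 2 powr (- (c * real (m + Suc J)))))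
    \<le> ennreal (G * (1 + real J) ^ P * 2 powr (- (c * real (Suc J))))"
proof -
  define x where "x = 2 powr (- c)"
  define g where "g m = (2 + real m) ^ P * x ^ m" for m
  have x: "0 < x" "x < 1" using c by (auto simp: x_def powr_less_one)
  have xpow: "2 powr (- (c * real m)) = x ^ m" for m
    by (simp add: x_def powr_powr powr_realpow[symmetric])
  have g0: "g m > 0" for m using x by (simp add: g_def)
  have "(\<lambda>m. ((3 + real m) / (2 + real m)) ^ P * x) \<longlonglongrightarrow> 1 ^ P * x"
  proof (intro tendsto_intros)
    have "(\<lambda>m. 1 + inverse (real (Suc (Suc m)))) \<longlonglongrightarrow> 1 + 0"
      by (intro tendsto_intros LIMSEQ_Suc[OF LIMSEQ_inverse_real_of_nat])
    then show "(\<lambda>m. (3 + real m) / (2 + real m)) \<longlonglongrightarrow> 1"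
      by (simp add: field_simps)
  qed
  \<comment> \<open>Any number strictly between \<open>x\<close> and 1 would serve as the ratio;
    this is the midpoint.\<close>
  then have "\<forall>\<^sub>F m in sequentially. ((3 + real m) / (2 + real m)) ^ P * x < (1 + x) / 2"
    using x by (intro order_tendstoD(2)) auto
  then obtain M where M: "\<And>m. m \<ge> M \<Longrightarrow> ((3 + real m) / (2 + real m)) ^ P * x < (1 + x) / 2"
    by (auto simp: eventually_sequentially)
  have sg: "summable g"
  proof (rule summable_ratio_test[of "(1 + x) / 2" M])
    show "(1 + x) / 2 < 1" using x by simp
    fix m assume m: "m \<ge> M"
    have "g (Suc m) = ((3 + real m) / (2 + real m)) ^ P * x * g m"
      by (simp add: g_def power_divide)
    also have "\<dots> \<le> (1 + x) / 2 * g m" using M[OF m] g0[of m] by (intro mult_right_mono) auto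
    finally show "norm (g (Suc m)) \<le> (1 + x) / 2 * norm (g m)" using g0[of m] g0[of "Suc m"] by simp
  qed
  have "(\<Sum>m. ennreal ((1 + real (m + Suc J)) ^ P * 2 powr (- (c * real (m + Suc J)))))
    \<le> ennreal (suminf g * (1 + real J) ^ P * 2 powr (- (c * real (Suc J))))" for J
  proof -
    let ?a = "(1 + real J) ^ P * x ^ Suc J"
    have le: "(1 + real (m + Suc J)) ^ P * x ^ (m + Suc J) \<le> ?a * g m" for m
    proof -
      have "1 + real (m + Suc J) \<le> (1 + real J) * (2 + real m)" by (simp add: algebra_simps)
      then have "(1 + real (m + Suc J)) ^ P \<le> ((1 + real J) * (2 + real m)) ^ P"
        by (intro power_mono) auto
      then have "(1 + real (m + Suc J)) ^ P * x ^ (m + Suc J) \<le> ((1 + real J) * (2 + real m)) ^ P * x ^ (m + Suc J)"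
        using x by (intro mult_right_mono) auto
      also have "\<dots> = ?a * g m" by (simp only: g_def power_mult_distrib power_add mult_ac)
      finally show ?thesis .
    qed
    have "(\<Sum>m. ennreal ((1 + real (m + Suc J)) ^ P * x ^ (m + Suc J))) \<le> (\<Sum>m. ennreal (?a * g m))"
      by (intro suminf_le ennreal_leI le summableI)
    also have "\<dots> = ennreal (\<Sum>m. ?a * g m)"
      using x g0 sg by (intro suminf_ennreal2 summable_mult) (auto intro!: mult_nonneg_nonneg less_imp_le)
    also have "(\<Sum>m. ?a * g m) = ?a * suminf g" using sg by (rule suminf_mult)
    finally show ?thesis unfolding xpow by (simp only: mult_ac)
  qed
  moreover have "suminf g > 0" using sg g0 by (rule suminf_pos)
  ultimately show ?thesis by blast
qed

text \<open>A minimum is at most any weighted geometric mean of its arguments; here the weights are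
  \<open>1 - r / 2\<close> and \<open>r / 2\<close>, both nonnegative in the given range of
  \<open>r\<close>.\<close>

lemma min_le_powr_mult:
  fixes u x :: real
  assumes "u > 0" "0 \<le> r" "r \<le> 2"
  shows "min u (x\<^sup>2) \<le> u powr (1 - r / 2) * \<bar>x\<bar> powr r"
proof (cases "x = 0")
  case True
  then show ?thesis using assms by simp
next
  case False
  define t where "t = min u (x\<^sup>2)"
  have t: "t > 0" "t \<le> u" "t \<le> x\<^sup>2" using assms False by (auto simp: t_def)
  have "t = t powr (1 - r / 2) * t powr (r / 2)"
    using t by (simp add: powr_add[symmetric])
  also have "\<dots> \<le> u powr (1 - r / 2) * (x\<^sup>2) powr (r / 2)"
    using t assms by (intro mult_mono powr_mono2) auto
  also have "(x\<^sup>2) powr (r / 2) = \<bar>x\<bar> powr r"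
  proof -
    have "x\<^sup>2 = \<bar>x\<bar> powr 2" using False by (simp add: powr_numeral)
    then show ?thesis by (simp only: powr_powr) simp
  qed
  finally show ?thesis by (simp add: t_def)
qed

text \<open>By the tail condition \<open>ln (1 / h q)\<close> is bounded through the power
  \<open>1 + \<kappa>\<close> of \<open>ln (1 + q)\<close>, and \<open>ln (1 + q)\<close> grows at
  most quadratically in \<open>l\<close> because \<open>ln (1 / s l)\<close> does. Hence the degree
  \<open>2 * (1 + \<kappa>)\<close>, rounded up to a natural number.\<close>

lemma log_prior_density_bound:
  assumes h: "heavy_tailed_density h" and H: "H > 0" and Q: "Q \<ge> 0"
    and s: "\<And>l. s l > 0" "\<And>l. s l \<le> S" and D: "\<And>l. ln (1 / s l) \<le> D * (1 + real l)\<^sup>2"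
  shows "\<exists>K>0. \<exists>P. \<forall>l q. 0 \<le> q \<longrightarrow> q \<le> Q / s l \<longrightarrow> 1 + ln (H / h q) \<le> K * (1 + real l) ^ P"
proof -
  obtain c1 \<kappa> where c1: "c1 > 0" and \<kappa>: "\<kappa> \<ge> 0"
    and tail: "\<And>x. x \<ge> 0 \<Longrightarrow> ln (1 / h x) \<le> c1 * (1 + ln (1 + x) powr (1 + \<kappa>))"
    using h unfolding heavy_tailed_density_def by blast
  have hp: "h y > 0" for y by (rule heavy_tailed_densityD(2)[OF h])
  have S: "S > 0" using s(1)[of 0] s(2)[of 0] by linarith
  define E where "E = \<bar>ln (S + Q)\<bar> + \<bar>D\<bar>"
  have E: "E \<ge> 0" by (simp add: E_def)
  define P where "P = nat \<lceil>2 * (1 + \<kappa>)\<rceil>"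
  have P: "2 * (1 + \<kappa>) \<le> real P" unfolding P_def by (rule real_nat_ceiling_ge)
  define K where "K = 1 + \<bar>ln H\<bar> + c1 + c1 * E powr (1 + \<kappa>)"
  have K: "K > 0" using c1 by (simp add: K_def add_pos_nonneg)
  have "1 + ln (H / h q) \<le> K * (1 + real l) ^ P" if q: "0 \<le> q" "q \<le> Q / s l" for l q
  proof -
    let ?A = "(1 + real l)"
    have A1: "1 \<le> ?A ^ P" "1 \<le> ?A\<^sup>2" by (auto intro!: one_le_power)
    \<comment> \<open>The upper bound \<open>S\<close> on the scales gives
      \<open>1 \<le> S / s l\<close>, which absorbs the summand 1.\<close>
    have "1 + q \<le> (S + Q) * (1 / s l)"
      using q s(1)[of l] s(2)[of l] by (simp add: field_simps)
    then have "ln (1 + q) \<le> ln ((S + Q) * (1 / s l))"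
      using q s(1)[of l] S Q by (subst ln_le_cancel_iff) auto
    also have "\<dots> = ln (S + Q) + ln (1 / s l)" using S Q s(1)[of l] by (intro ln_mult_pos) auto
    also have "\<dots> \<le> \<bar>ln (S + Q)\<bar> * ?A\<^sup>2 + \<bar>D\<bar> * ?A\<^sup>2"
    proof (rule add_mono)
      show "ln (S + Q) \<le> \<bar>ln (S + Q)\<bar> * ?A\<^sup>2"
        using mult_left_mono[OF A1(2), of "\<bar>ln (S + Q)\<bar>"] by simp
      show "ln (1 / s l) \<le> \<bar>D\<bar> * ?A\<^sup>2"
        by (rule order_trans[OF D]) (intro mult_right_mono, auto)
    qed
    also have "\<dots> = E * ?A powr 2" by (simp add: E_def powr_numeral distrib_right)
    finally have "ln (1 + q) powr (1 + \<kappa>) \<le> (E * ?A powr 2) powr (1 + \<kappa>)"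
      using q \<kappa> by (intro powr_mono2) auto
    also have "\<dots> = E powr (1 + \<kappa>) * ?A powr (2 * (1 + \<kappa>))"
      using E by (subst powr_mult) (simp_all only: powr_powr)
    also have "\<dots> \<le> E powr (1 + \<kappa>) * ?A powr real P"
      using P by (intro mult_left_mono powr_mono) auto
    also have "?A powr real P = ?A ^ P" by (simp add: powr_realpow)
    finally have le: "ln (1 + q) powr (1 + \<kappa>) \<le> E powr (1 + \<kappa>) * ?A ^ P" .
    have "1 + ln (H / h q) = 1 + ln H + ln (1 / h q)"
      using H hp[of q] by (simp add: ln_div)
    also have "\<dots> \<le> 1 + ln H + c1 * (1 + E powr (1 + \<kappa>) * ?A ^ P)"
      using tail[OF q(1)] c1 le mult_left_mono[OF add_left_mono[OF le], of c1 1] by linarith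
    also have "\<dots> \<le> (1 + \<bar>ln H\<bar> + c1) * 1 + c1 * E powr (1 + \<kappa>) * ?A ^ P"
      by (simp add: algebra_simps)
    also have "\<dots> \<le> (1 + \<bar>ln H\<bar> + c1) * ?A ^ P + c1 * E powr (1 + \<kappa>) * ?A ^ P"
      using c1 A1(1) by (intro add_right_mono mult_left_mono) auto
    also have "\<dots> = K * ?A ^ P" by (simp add: K_def algebra_simps)
    finally show ?thesis .
  qed
  with K show ?thesis by blast
qed

section \<open>Summation over the levels\<close>

lemma powr_square: "(x powr y)\<^sup>2 = x powr (2 * y)" for x y :: real
  by (simp only: power2_eq_square powr_add[symmetric] mult_2)

text \<open>The upper bound on \<open>s\<close> makes the prior at least as regular as
  \<open>\<beta>\<close>: the \<open>2 ^ l\<close> terms \<open>(s l)\<^sup>2\<close> of level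
  \<open>l\<close> add up to order \<open>2 powr (- (2 * \<beta> * l))\<close>. The levels up to
  \<open>J\<close> cost \<open>2 ^ J / n\<close>, those above cost a prior part and a Besov part,
  and the cut-off \<open>J\<close> balances the three up to the logarithmic factor.\<close>

lemma total_risk_bound:
  fixes h :: "real \<Rightarrow> real" and f0 :: "nat \<times> nat \<Rightarrow> real" and \<beta> L r :: real
  assumes h: "heavy_tailed_density h"
    and \<beta>: "\<beta> > 0" and L: "L > 0" and r: "1 \<le> r" "r \<le> 2" and \<beta>r: "\<beta> > 1 / r - 1 / 2"
    and f0: "f0 \<in> besov_ball \<beta> r L"
    and s: "\<And>l. s l > 0" "\<And>l. s l \<le> S * 2 powr (- (real l * (1 / 2 + \<beta>)))"
    and D: "\<And>l. ln (1 / s l) \<le> D * (1 + real l)\<^sup>2"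
  shows "\<exists>A>0. \<exists>P. \<forall>n>0.
    (\<Sum>l. \<Sum>k<2 ^ l. \<integral>\<^sup>+ x. (\<integral>\<^sup>+ \<theta>. ennreal ((\<theta> - f0 (l, k))\<^sup>2) \<partial>posterior_coord n h (s l) x)
        \<partial>density lborel (normal_density (f0 (l, k)) (1 / sqrt n)))
      \<le> ennreal (A * (1 + log 2 n) ^ P * real n powr (- (2 * \<beta> / (2 * \<beta> + 1))))"
proof -
  have hp: "h y > 0" for y by (rule heavy_tailed_densityD(2)[OF h])
  obtain H where "\<And>y. \<bar>h y\<bar> \<le> H"
    using h unfolding heavy_tailed_density_def bounded_real by blast
  then have H: "\<And>y. h y \<le> H" by (metis abs_ge_self order_trans)
  have Hp: "H > 0" using hp H by (rule less_le_trans)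
  define R where "R n l k = (\<integral>\<^sup>+ x. (\<integral>\<^sup>+ \<theta>. ennreal ((\<theta> - f0 (l, k))\<^sup>2) \<partial>posterior_coord n h (s l) x)
        \<partial>density lborel (normal_density (f0 (l, k)) (1 / sqrt (real n))))" for n l k
  define q where "q n l k = (\<bar>f0 (l, k)\<bar> + 1 / sqrt (real n)) / s l" for n l k
  obtain C where C: "C > 0" and R: "\<And>n l k. n > 0 \<Longrightarrow> R n l k \<le> ennreal (C * min ((1 + ln (H / h (q n l k))) / n)
          ((s l)\<^sup>2 + (1 + ln (H / h (q n l k))) * min (1 / n) ((f0 (l, k))\<^sup>2)))"
    using coordinate_risk_bound[OF h H] s(1) unfolding R_def q_def by metis
  have S: "S > 0"
    using s(1)[of 0] s(2)[of 0] by simp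
  have sS: "s l \<le> S" for l
  proof (rule order_trans[OF s(2)])
    have "2 powr (- (real l * (1 / 2 + \<beta>))) \<le> 2 powr 0" using \<beta> by (intro powr_mono) auto
    then show "S * 2 powr (- (real l * (1 / 2 + \<beta>))) \<le> S" using S mult_left_mono by fastforce
  qed
  \<comment> \<open>The bound \<open>L + 1\<close> is that of
    \<open>\<bar>f0 (l, k)\<bar> + 1 / sqrt n\<close>.\<close>
  obtain K P where K: "K > 0"
    and ell: "\<And>l q. 0 \<le> q \<Longrightarrow> q \<le> (L + 1) / s l \<Longrightarrow> 1 + ln (H / h q) \<le> K * (1 + real l) ^ P"
    using log_prior_density_bound[OF h Hp _ s(1) sS D, of "L + 1"] L by auto
  define a where "a = \<beta> + 1/2 - 1/r"
  have a: "r * a > 0" using \<beta>r r by (simp add: a_def)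
  have \<beta>2: "2 * \<beta> > 0" using \<beta> by simp
  obtain G1 where G1: "G1 > 0" "\<And>J. (\<Sum>m. ennreal ((1 + real (m + Suc J)) ^ P * 2 powr (- ((2 * \<beta>) * real (m + Suc J)))))
    \<le> ennreal (G1 * (1 + real J) ^ P * 2 powr (- ((2 * \<beta>) * real (Suc J))))"
    using tail_sum_le[OF \<beta>2, of P] by blast
  obtain G2 where G2: "G2 > 0" "\<And>J. (\<Sum>m. ennreal ((1 + real (m + Suc J)) ^ P * 2 powr (- ((r * a) * real (m + Suc J)))))
    \<le> ennreal (G2 * (1 + real J) ^ P * 2 powr (- ((r * a) * real (Suc J))))"
    using tail_sum_le[OF a, of P] by blast
  \<comment> \<open>One summand each for the levels up to \<open>J\<close>, for the prior variances
    above \<open>J\<close>, and for the coefficients of \<open>f0\<close> above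
    \<open>J\<close>.\<close>
  define A where "A = 2 * C * K + C * S\<^sup>2 * G1 + C * K * L powr r * G2"
  have A: "A > 0" using C K S G1(1) G2(1) by (auto simp: A_def intro!: add_pos_nonneg)
  have "(\<Sum>l. \<Sum>k<2 ^ l. R n l k) \<le> ennreal (A * (1 + log 2 n) ^ P * real n powr (- (2 * \<beta> / (2 * \<beta> + 1))))"
    if n: "n > 0" for n :: nat
  proof -
    define u where "u = (1 / real n) powr (1 - r / 2)"
    have u: "u > 0" using n by (simp add: u_def)
    have ellk: "1 + ln (H / h (q n l k)) \<le> K * (1 + real l) ^ P" if "k < 2 ^ l" for l k
    proof (rule ell)
      show "0 \<le> q n l k" using s(1)[of l] by (simp add: q_def)
      have "\<bar>f0 (l, k)\<bar> \<le> L"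
        using besov_ball_coefficient_le[OF f0 L r(1) \<beta>r that] .
      moreover have "1 / sqrt n \<le> 1" using n by simp
      ultimately show "q n l k \<le> (L + 1) / s l"
        unfolding q_def using s(1)[of l] by (intro divide_right_mono) auto
    qed
    have R1: "R n l k \<le> ennreal (C * (K * (1 + real l) ^ P / n))" if "k < 2 ^ l" for l k
    proof (rule order_trans[OF R[OF n] ennreal_leI])
      show "C * min ((1 + ln (H / h (q n l k))) / n) ((s l)\<^sup>2 + (1 + ln (H / h (q n l k))) * min (1 / n) ((f0 (l, k))\<^sup>2))
        \<le> C * (K * (1 + real l) ^ P / n)"
        using C ellk[OF that] by (intro mult_left_mono min.coboundedI1 divide_right_mono) auto
    qed
    have R2: "R n l k \<le> ennreal (C * (S\<^sup>2 * 2 powr (- (real l * (1 + 2 * \<beta>))) + K * (1 + real l) ^ P * (u * \<bar>f0 (l, k)\<bar> powr r)))"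
      if "k < 2 ^ l" for l k
    proof (rule order_trans[OF R[OF n] ennreal_leI])
      have "(s l)\<^sup>2 \<le> (S * 2 powr (- (real l * (1 / 2 + \<beta>))))\<^sup>2"
        using s(1)[of l] s(2)[of l] by (intro power_mono) auto
      also have "\<dots> = S\<^sup>2 * 2 powr (- (real l * (1 + 2 * \<beta>)))"
      proof -
        have "2 * - (real l * (1 / 2 + \<beta>)) = - (real l * (1 + 2 * \<beta>))" by (simp add: algebra_simps)
        then show ?thesis by (simp only: power_mult_distrib powr_square)
      qed
      finally have s2: "(s l)\<^sup>2 \<le> S\<^sup>2 * 2 powr (- (real l * (1 + 2 * \<beta>)))" .
      have m: "min (1 / n) ((f0 (l, k))\<^sup>2) \<le> u * \<bar>f0 (l, k)\<bar> powr r"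
        unfolding u_def using n r by (intro min_le_powr_mult) auto
      have "(1 + ln (H / h (q n l k))) * min (1 / n) ((f0 (l, k))\<^sup>2) \<le> K * (1 + real l) ^ P * (u * \<bar>f0 (l, k)\<bar> powr r)"
        using ellk[OF that] m K by (intro mult_mono) auto
      then show "C * min ((1 + ln (H / h (q n l k))) / n) ((s l)\<^sup>2 + (1 + ln (H / h (q n l k))) * min (1 / n) ((f0 (l, k))\<^sup>2))
        \<le> C * (S\<^sup>2 * 2 powr (- (real l * (1 + 2 * \<beta>))) + K * (1 + real l) ^ P * (u * \<bar>f0 (l, k)\<bar> powr r))"
        using C s2 by (intro mult_left_mono min.coboundedI2 add_mono) auto
    qed
    \<comment> \<open>\<open>N\<close> is the effective number of coefficients and
      \<open>2 ^ J\<close> its dyadic rounding from below. The head is controlled by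
      \<open>2 ^ J \<le> N\<close>; the tail starts at level \<open>Suc J\<close>, where
      \<open>N < 2 ^ Suc J\<close> holds. \<open>Y\<close> is the square of the rate.\<close>
    define N where "N = real n powr (1 / (2 * \<beta> + 1))"
    define J where "J = nat \<lfloor>log 2 N\<rfloor>"
    define Y where "Y = real n powr (- (2 * \<beta> / (2 * \<beta> + 1)))"
    have b1: "2 * \<beta> + 1 > 0" using \<beta> by simp
    have N: "N \<ge> 1" using n b1 by (auto simp: N_def intro!: ge_one_powr_ge_zero)
    have "log 2 N \<ge> 0" using N by (simp add: zero_le_log_cancel_iff)
    then have J: "real J \<le> log 2 N" "log 2 N < real (Suc J)"
      unfolding J_def by linarith+
    have JN: "2 powr real J \<le> N" "N < 2 powr real (Suc J)"
      using J N by (simp_all add: le_log_iff log_less_iff del: of_nat_Suc)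
    have "log 2 N = 1 / (2 * \<beta> + 1) * log 2 n" using n by (simp add: N_def log_powr)
    also have "\<dots> \<le> 1 * log 2 n" using n \<beta> by (intro mult_right_mono) (auto simp: zero_le_log_cancel_iff)
    finally have Jn: "real J \<le> log 2 n" using J(1) by simp
    \<comment> \<open>With this \<open>N\<close> the head, the prior tail and the Besov tail all
      have order \<open>Y\<close>, as \<open>Y1\<close>, \<open>Y2\<close> and \<open>Y3\<close>
      state.\<close>
    have Y1: "N / n = Y"
    proof -
      have "N / n = N * real n powr (- 1)" using n by (simp add: powr_minus field_simps)
      also have "\<dots> = Y" unfolding N_def Y_def powr_add[symmetric] using b1 by (intro arg_cong2[of _ _ _ _ "(powr)"]) (auto simp: field_simps)
      finally show ?thesis .
    qed
    have Y2: "N powr (- (2 * \<beta>)) = Y"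
      unfolding N_def Y_def powr_powr by simp
    have Y3: "u * N powr (- (r * a)) = Y"
    proof -
      have "u = real n powr (- (1 - r / 2))" using n by (simp only: u_def powr_minus) (simp add: powr_divide inverse_eq_divide)
      moreover have "- (1 - r / 2) + 1 / (2 * \<beta> + 1) * (- (r * a)) = - (2 * \<beta> / (2 * \<beta> + 1))"
      proof -
        \<comment> \<open>Divided by \<open>2 * \<beta> + 1\<close>, this form yields
          \<open>r / 2 - 1 / (2 * \<beta> + 1)\<close>, whose \<open>r / 2\<close> cancels against
          the one from \<open>u\<close>.\<close>
        have eq: "r * a = r * (2 * \<beta> + 1) / 2 - 1" using r by (simp add: a_def field_simps)
        show ?thesis unfolding eq using b1 by (simp add: field_simps)
      qed
      ultimately show ?thesis unfolding N_def Y_def powr_powr by (simp only: powr_add[symmetric])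
    qed
    have pN: "2 powr (- (c * real (Suc J))) \<le> N powr (- c)" if "c > 0" for c
    proof -
      have "2 powr (- (c * real (Suc J))) = (2 powr real (Suc J)) powr (- c)" by (simp add: powr_powr mult.commute)
      also have "\<dots> \<le> N powr (- c)" using that JN(2) N by (intro powr_mono2') auto
      finally show ?thesis .
    qed
    define Q where "Q = (1 + real J) ^ P"
    have Q: "Q > 0" by (simp add: Q_def)
    have head: "(\<Sum>k<2 ^ l. R n l k) \<le> ennreal (2 ^ l * (C * (K * Q / n)))" if "l < Suc J" for l
    proof -
      have "(\<Sum>k<2 ^ l. R n l k) \<le> (\<Sum>k<(2::nat) ^ l. ennreal (C * (K * Q / n)))"
      proof (intro sum_mono)
        fix k :: nat assume "k \<in> {..<2 ^ l}"
        then have "R n l k \<le> ennreal (C * (K * (1 + real l) ^ P / n))" by (intro R1) auto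
        also have "\<dots> \<le> ennreal (C * (K * Q / n))"
          unfolding Q_def using that C K by (intro ennreal_leI mult_left_mono divide_right_mono power_mono) auto
        finally show "R n l k \<le> ennreal (C * (K * Q / n))" .
      qed
      also have "\<dots> = ennreal (\<Sum>k<(2::nat) ^ l. C * (K * Q / n))"
        using C K Q by (intro sum_ennreal) auto
      also have "(\<Sum>k<(2::nat) ^ l. C * (K * Q / n)) = 2 ^ l * (C * (K * Q / n))" by simp
      finally show ?thesis .
    qed
    define b1 where "b1 = C * S\<^sup>2"
    define b2 where "b2 = C * K * u * L powr r"
    have b: "b1 \<ge> 0" "b2 \<ge> 0" using C K u by (auto simp: b1_def b2_def)
    have tail: "(\<Sum>k<2 ^ l. R n l k) \<le> ennreal b1 * ennreal ((1 + real l) ^ P * 2 powr (- ((2 * \<beta>) * real l)))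
        + ennreal b2 * ennreal ((1 + real l) ^ P * 2 powr (- ((r * a) * real l)))" for l
    proof -
      let ?x = "S\<^sup>2 * 2 powr (- (real l * (1 + 2 * \<beta>)))"
      let ?y = "\<lambda>k. K * (1 + real l) ^ P * (u * \<bar>f0 (l, k)\<bar> powr r)"
      have "(\<Sum>k<2 ^ l. R n l k) \<le> (\<Sum>k<(2::nat) ^ l. ennreal (C * (?x + ?y k)))"
        by (intro sum_mono R2) auto
      also have "\<dots> = ennreal (\<Sum>k<(2::nat) ^ l. C * (?x + ?y k))"
        using C K u by (intro sum_ennreal) (auto intro!: mult_nonneg_nonneg add_nonneg_nonneg)
      also have "(\<Sum>k<(2::nat) ^ l. C * (?x + ?y k)) = b1 * (2 ^ l * 2 powr (- (real l * (1 + 2 * \<beta>))))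
          + C * K * u * (1 + real l) ^ P * (\<Sum>k<(2::nat) ^ l. \<bar>f0 (l, k)\<bar> powr r)"
        by (simp add: sum.distrib sum_distrib_left[symmetric] distrib_left b1_def mult_ac)
      also have "2 ^ l * 2 powr (- (real l * (1 + 2 * \<beta>))) = 2 powr (- ((2 * \<beta>) * real l))"
        by (simp add: powr_realpow[symmetric] powr_add[symmetric] algebra_simps)
      also have "ennreal (b1 * 2 powr (- ((2 * \<beta>) * real l)) + C * K * u * (1 + real l) ^ P * (\<Sum>k<(2::nat) ^ l. \<bar>f0 (l, k)\<bar> powr r))
        \<le> ennreal (b1 * ((1 + real l) ^ P * 2 powr (- ((2 * \<beta>) * real l)))
          + C * K * u * (1 + real l) ^ P * (L powr r * 2 powr (- ((r * a) * real l))))"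
      proof (intro ennreal_leI add_mono mult_left_mono)
        \<comment> \<open>The polynomial factor, at least 1, is inserted so that both tails have the
          shape of \<open>tail_sum_le\<close>.\<close>
        show "2 powr (- ((2 * \<beta>) * real l)) \<le> (1 + real l) ^ P * 2 powr (- ((2 * \<beta>) * real l))"
          by (simp add: one_le_power)
        show "(\<Sum>k<(2::nat) ^ l. \<bar>f0 (l, k)\<bar> powr r) \<le> L powr r * 2 powr (- ((r * a) * real l))"
          unfolding a_def by (rule besov_ball_level[OF f0])
      qed (use C K u b in auto)
      also have "\<dots> = ennreal (b1 * ((1 + real l) ^ P * 2 powr (- ((2 * \<beta>) * real l)))
          + b2 * ((1 + real l) ^ P * 2 powr (- ((r * a) * real l))))"
        by (simp add: b2_def mult_ac)
      finally show ?thesis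
        using b by (simp add: ennreal_mult[symmetric] ennreal_plus[symmetric] del: ennreal_plus)
    qed
    have "(\<Sum>l. \<Sum>k<2 ^ l. R n l k) = (\<Sum>m. \<Sum>k<2 ^ (m + Suc J). R n (m + Suc J) k) + (\<Sum>l<Suc J. \<Sum>k<2 ^ l. R n l k)"
      by (rule suminf_offset) (rule summableI)
    also have "(\<Sum>l<Suc J. \<Sum>k<2 ^ l. R n l k) \<le> (\<Sum>l<Suc J. ennreal (2 ^ l * (C * (K * Q / n))))"
      by (intro sum_mono head) auto
    also have "\<dots> = ennreal (\<Sum>l<Suc J. 2 ^ l * (C * (K * Q / n)))"
      using C K Q by (intro sum_ennreal) auto
    also have "\<dots> \<le> ennreal (2 * C * K * Q * Y)"
    proof (rule ennreal_leI)
      have "(\<Sum>l<Suc J. 2 ^ l * (C * (K * Q / n))) = (2 ^ Suc J - 1) * (C * (K * Q / n))"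
        unfolding sum_distrib_right[symmetric] using power_diff_1_eq[of "2 :: real" "Suc J"]
        by (simp del: power_Suc sum.lessThan_Suc)
      also have "\<dots> \<le> (2 * N) * (C * (K * Q / n))"
        using JN(1) C K Q by (intro mult_right_mono) (auto simp: powr_realpow)
      also have "\<dots> = 2 * C * K * Q * (N / n)" by simp
      finally show "(\<Sum>l<Suc J. 2 ^ l * (C * (K * Q / n))) \<le> 2 * C * K * Q * Y" unfolding Y1 .
    qed
    also have "(\<Sum>m. \<Sum>k<2 ^ (m + Suc J). R n (m + Suc J) k) \<le>
        (\<Sum>m. ennreal b1 * ennreal ((1 + real (m + Suc J)) ^ P * 2 powr (- ((2 * \<beta>) * real (m + Suc J))))
        + ennreal b2 * ennreal ((1 + real (m + Suc J)) ^ P * 2 powr (- ((r * a) * real (m + Suc J)))))"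
      by (intro suminf_le tail summableI)
    also have "\<dots> = ennreal b1 * (\<Sum>m. ennreal ((1 + real (m + Suc J)) ^ P * 2 powr (- ((2 * \<beta>) * real (m + Suc J)))))
        + ennreal b2 * (\<Sum>m. ennreal ((1 + real (m + Suc J)) ^ P * 2 powr (- ((r * a) * real (m + Suc J)))))"
      by (simp only: suminf_add[OF summableI summableI, symmetric] ennreal_suminf_cmult)
    also have "\<dots> \<le> ennreal b1 * ennreal (G1 * Q * N powr (- (2 * \<beta>))) + ennreal b2 * ennreal (G2 * Q * N powr (- (r * a)))"
    proof (intro add_mono mult_left_mono)
      show "(\<Sum>m. ennreal ((1 + real (m + Suc J)) ^ P * 2 powr (- ((2 * \<beta>) * real (m + Suc J))))) \<le> ennreal (G1 * Q * N powr (- (2 * \<beta>)))"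
        using pN[of "2 * \<beta>"] \<beta> G1(1) Q by (intro order_trans[OF G1(2)] ennreal_leI) (simp add: Q_def del: of_nat_Suc)
      show "(\<Sum>m. ennreal ((1 + real (m + Suc J)) ^ P * 2 powr (- ((r * a) * real (m + Suc J))))) \<le> ennreal (G2 * Q * N powr (- (r * a)))"
        using pN[OF a] G2(1) Q by (intro order_trans[OF G2(2)] ennreal_leI) (simp add: Q_def del: of_nat_Suc)
    qed auto
    also have "ennreal b1 * ennreal (G1 * Q * N powr (- (2 * \<beta>))) + ennreal b2 * ennreal (G2 * Q * N powr (- (r * a))) + ennreal (2 * C * K * Q * Y)
      = ennreal (b1 * (G1 * Q * N powr (- (2 * \<beta>))) + b2 * (G2 * Q * N powr (- (r * a))) + 2 * C * K * Q * Y)"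
      using b G1(1) G2(1) Q C K by (simp add: ennreal_mult ennreal_plus Y_def del: ennreal_plus)
        (simp add: ennreal_plus ennreal_mult)
    also have "b1 * (G1 * Q * N powr (- (2 * \<beta>))) + b2 * (G2 * Q * N powr (- (r * a))) + 2 * C * K * Q * Y
      = b1 * G1 * Q * N powr (- (2 * \<beta>)) + C * K * L powr r * G2 * Q * (u * N powr (- (r * a))) + 2 * C * K * Q * Y"
      by (simp add: b2_def mult_ac)
    also have "\<dots> = A * Q * Y" unfolding Y2 Y3 by (simp add: A_def b1_def algebra_simps)
    also have "\<dots> \<le> A * (1 + log 2 n) ^ P * Y"
      unfolding Q_def using Jn A by (intro mult_right_mono mult_left_mono power_mono) (auto simp: Y_def)
    finally show ?thesis unfolding Y_def by (simp add: ennreal_leI)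
  qed
  with A show ?thesis unfolding R_def by blast
qed

section \<open>Contraction rate\<close>

text \<open>Common to both choices of the prior scales, which enter only through a geometric upper
  bound and an at most quadratic growth of \<open>ln (1 / s l)\<close>. The claim is the risk bound
  divided by the squared radius.\<close>

lemma posterior_contraction:
  fixes h :: "real \<Rightarrow> real" and f0 :: "nat \<times> nat \<Rightarrow> real" and \<beta> L r :: real
  assumes h: "heavy_tailed_density h"
    and \<beta>: "\<beta> > 0" and L: "L > 0" and r: "1 \<le> r" "r \<le> 2" and \<beta>r: "\<beta> > 1 / r - 1 / 2"
    and f0: "f0 \<in> besov_ball \<beta> r L"
    and s: "\<And>l. s l > 0" "\<And>l. s l \<le> S * 2 powr (- (real l * (1 / 2 + \<beta>)))"
    and D: "\<And>l. ln (1 / s l) \<le> D * (1 + real l)\<^sup>2"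
  shows "\<exists>d>0. (\<lambda>n. expected_posterior_outside n h s f0
      (ln (real n) powr d * real n powr (- \<beta> / (2 * \<beta> + 1)))) \<longlonglongrightarrow> 0"
proof -
  obtain A P where A: "A > 0" and risk: "\<And>n. n > 0 \<Longrightarrow>
    (\<Sum>l. \<Sum>k<2 ^ l. \<integral>\<^sup>+ x. (\<integral>\<^sup>+ \<theta>. ennreal ((\<theta> - f0 (l, k))\<^sup>2) \<partial>posterior_coord n h (s l) x)
        \<partial>density lborel (normal_density (f0 (l, k)) (1 / sqrt n)))
      \<le> ennreal (A * (1 + log 2 n) ^ P * real n powr (- (2 * \<beta> / (2 * \<beta> + 1))))"
    using total_risk_bound[OF h \<beta> L r \<beta>r f0 s D] by blast
  \<comment> \<open>The squared radius then carries the power \<open>P + 1\<close> of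
    \<open>ln n\<close>: \<open>P\<close> of these factors compensate the logarithms in the risk
    bound, and the last one sends the quotient to 0.\<close>
  define d where "d = (real P + 1) / 2"
  define E where "E n = expected_posterior_outside n h s f0 (ln (real n) powr d * real n powr (- \<beta> / (2 * \<beta> + 1)))" for n
  have E0: "E n \<ge> 0" for n
    unfolding E_def expected_posterior_outside_def by (intro Bochner_Integration.integral_nonneg) auto
  \<comment> \<open>From 3 on \<open>ln n\<close> is at least 1. The radius degenerates to 0 at
    \<open>n = 1\<close>, which does not affect the limit.\<close>
  have Ele: "E n \<le> A * 3 ^ P / ln n" if n: "n \<ge> 3" for n :: nat
  proof -
    have ln1: "ln n \<ge> 1"
      using exp_le n by (subst ln_ge_iff) auto
    define Y where "Y = real n powr (- (2 * \<beta> / (2 * \<beta> + 1)))"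
    have Y: "Y > 0" using n by (simp add: Y_def)
    define \<epsilon> where "\<epsilon> = ln (real n) powr d * real n powr (- \<beta> / (2 * \<beta> + 1))"
    have \<epsilon>: "\<epsilon> > 0" using ln1 n by (simp add: \<epsilon>_def)
    have "\<epsilon>\<^sup>2 = ln (real n) powr (2 * d) * Y"
      by (simp add: \<epsilon>_def Y_def power_mult_distrib powr_square)
    also have "ln (real n) powr (2 * d) = ln n ^ P * ln n"
    proof -
      have "2 * d = real P + 1" by (simp add: d_def field_simps)
      then show ?thesis using ln1 by (simp add: powr_add powr_realpow)
    qed
    finally have \<epsilon>2: "\<epsilon>\<^sup>2 = ln n ^ P * ln n * Y" .
    have l0: "log 2 n \<ge> 0" using n by (simp add: zero_le_log_cancel_iff)
    have "ln n \<le> ln n * (2 * ln 2)" using ln2_ge_two_thirds ln1 by simp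
    then have "log 2 n \<le> 2 * ln n" by (simp add: log_def field_simps)
    then have "1 + log 2 n \<le> 3 * ln n" using ln1 by linarith
    then have "(1 + log 2 n) ^ P \<le> (3 * ln n) ^ P" using l0 by (intro power_mono) auto
    then have "A * (1 + log 2 n) ^ P * Y \<le> A * (3 ^ P * ln n ^ P) * Y"
      using A Y by (simp add: power_mult_distrib)
    then have "A * (1 + log 2 n) ^ P * Y / \<epsilon>\<^sup>2 \<le> A * (3 ^ P * ln n ^ P) * Y / \<epsilon>\<^sup>2"
      by (rule divide_right_mono) simp
    also have "\<dots> = A * 3 ^ P / ln n" unfolding \<epsilon>2 using Y ln1 by simp
    finally have le: "A * (1 + log 2 n) ^ P * Y / \<epsilon>\<^sup>2 \<le> A * 3 ^ P / ln n" .
    have "E n \<le> A * (1 + log 2 n) ^ P * Y / \<epsilon>\<^sup>2"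
      unfolding E_def \<epsilon>_def[symmetric] using n A Y l0 risk[of n]
      by (intro expected_posterior_outside_le[OF h s(1) _ \<epsilon>]) (auto simp: Y_def)
    with le show ?thesis by simp
  qed
  have lim: "(\<lambda>n. A * 3 ^ P / ln (real n)) \<longlonglongrightarrow> 0"
    by (intro tendsto_divide_0[OF tendsto_const] filterlim_compose[OF ln_at_top filterlim_real_sequentially]
      filterlim_at_top_imp_at_infinity)
  have "E \<longlonglongrightarrow> 0"
    by (rule tendsto_sandwich[OF _ _ tendsto_const lim])
      (use E0 Ele in \<open>auto intro: eventually_sequentiallyI[of 3]\<close>)
  moreover have "d > 0" by (simp add: d_def)
  ultimately show ?thesis unfolding E_def by blast
qed

theorem theorem4:
  fixes h :: "real \<Rightarrow> real" and f0 :: "nat \<times> nat \<Rightarrow> real" and \<beta> L r :: real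
  assumes "heavy_tailed_density h"
    and "\<beta> > 0" and "L > 0" and "1 \<le> r" and "r \<le> 2" and "\<beta> > 1 / r - 1 / 2"
    and "f0 \<in> besov_ball \<beta> r L"
  shows "(\<exists>d>0. (\<lambda>n. expected_posterior_outside n h (\<lambda>l. 2 powr (- (real l)\<^sup>2)) f0
                     (ln (real n) powr d * real n powr (- \<beta> / (2 * \<beta> + 1)))) \<longlonglongrightarrow> 0) \<and>
    (\<forall>\<alpha>>0. \<alpha> \<ge> \<beta> \<longrightarrow>
       (\<exists>d>0. (\<lambda>n. expected_posterior_outside n h (\<lambda>l. 2 powr (- (real l * (1 / 2 + \<alpha>)))) f0
                     (ln (real n) powr d * real n powr (- \<beta> / (2 * \<beta> + 1)))) \<longlonglongrightarrow> 0))"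
proof (intro conjI allI impI)
  have ln_inv: "ln (1 / (2 powr (- x))) = x * ln 2" for x :: real
    by (simp add: ln_div ln_powr)
  have ln2: "0 < ln (2::real)" "ln (2::real) \<le> 1"
    using ln_le_minus_one[of "2::real"] by auto
  show "\<exists>d>0. (\<lambda>n. expected_posterior_outside n h (\<lambda>l. 2 powr (- (real l)\<^sup>2)) f0
                     (ln (real n) powr d * real n powr (- \<beta> / (2 * \<beta> + 1)))) \<longlonglongrightarrow> 0"
  proof (rule posterior_contraction[OF assms])
    fix l :: nat
    let ?g = "1 / 2 + \<beta>"
    \<comment> \<open>The scale \<open>2 powr (- (real l)\<^sup>2)\<close> lies below every
      geometric one; this inequality between mixed product and squares supplies the constant
      \<open>S = 2 powr (?g\<^sup>2)\<close>.\<close>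
    have "real l * ?g \<le> ?g\<^sup>2 + (real l)\<^sup>2"
      using sum_squares_bound[of "real l" ?g] zero_le_power2[of "real l"] zero_le_power2[of ?g]
      by (simp only: mult.assoc)
    then have "2 powr (- (real l)\<^sup>2) \<le> 2 powr (?g\<^sup>2 + - (real l * ?g))"
      by (intro powr_mono) auto
    then show "2 powr (- (real l)\<^sup>2) \<le> 2 powr (?g\<^sup>2) * 2 powr (- (real l * ?g))"
      by (simp only: powr_add)
    have "(real l)\<^sup>2 * ln 2 \<le> (1 + real l)\<^sup>2 * 1"
      using ln2 by (intro mult_mono power_mono) auto
    then show "ln (1 / 2 powr (- (real l)\<^sup>2)) \<le> 1 * (1 + real l)\<^sup>2"
      unfolding ln_inv by simp
  qed simp
  fix \<alpha> :: real assume \<alpha>: "\<alpha> > 0" "\<alpha> \<ge> \<beta>"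
  show "\<exists>d>0. (\<lambda>n. expected_posterior_outside n h (\<lambda>l. 2 powr (- (real l * (1 / 2 + \<alpha>)))) f0
                     (ln (real n) powr d * real n powr (- \<beta> / (2 * \<beta> + 1)))) \<longlonglongrightarrow> 0"
  proof (rule posterior_contraction[OF assms])
    fix l :: nat
    \<comment> \<open>Here \<open>\<alpha> \<ge> \<beta>\<close> gives the upper bound with
      \<open>S = 1\<close>. The logarithm of the inverse scale is linear in \<open>l\<close>, so
      \<open>D = 1 / 2 + \<alpha>\<close> suffices.\<close>
    show "2 powr (- (real l * (1 / 2 + \<alpha>))) \<le> 1 * 2 powr (- (real l * (1 / 2 + \<beta>)))"
      using \<alpha> by (simp add: mult_left_mono)
    have "real l * (1 / 2 + \<alpha>) * ln 2 \<le> (1 + real l)\<^sup>2 * (1 / 2 + \<alpha>) * 1"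
      using ln2 \<alpha> by (intro mult_mono) (auto simp: power2_eq_square algebra_simps)
    then show "ln (1 / 2 powr (- (real l * (1 / 2 + \<alpha>)))) \<le> (1 / 2 + \<alpha>) * (1 + real l)\<^sup>2"
      unfolding ln_inv by (simp add: mult.commute)
  qed simp
qed

end
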